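(* For every integer $n$ with $1 \le n \le 3$ we have $\mathcal{MBV}_{n,n} = \mathcal{GSV}_n$, and for every integer $n \geq 4$ we have $\mathcal{MBV}_{n,n} \subsetneq \mathcal{GSV}_n$.
   Context: Let $[n]=\{1,\dots,n\}$. A valuation with ground set $E \subseteq [n]$ is a function $u: 2^E \to \mathbb{R}_{\geq 0}$ with $u(\emptyset)=0$ and $u(S)\le u(T)$ whenever $S \subseteq T$; two valuations are equal only if they have the same ground set and agree everywhere. For $p \in \mathbb{R}^E$ let $D(u,p)=\arg\max_{S \subseteq E}\big(u(S)-\sum_{i\in S}p_i\big)$. The valuation $u$ is gross substitutes if for all $p,q \in \mathbb{R}^E$ with $p \le q$ coordinatewise and every $S \in D(u,p)$ there is $T \in D(u,q)$ with $\{i \in S: p_i=q_i\}\subseteq T$. $\mathcal{GSV}_n$ is the set of gross substitutes valuations whose ground set is some subset of $[n]$. Merging: for valuations $u^1$ on $E^1$ and $u^2$ on $E^2$, $u^1 \ast u^2$ is the valuation on $E^1\cup E^2$ given by $(u^1\ast u^2)(S)=\max\{u^1(T)+u^2(S\setminus T): T \subseteq S\cap E^1,\ S\setminus T \subseteq E^2\}$. Endowment: for a valuation $u$ on $E$ and $T\subseteq E$, $\partial^T u$ is the valuation on $E\setminus T$ given by $\partial^T u(S)=u(S\cup T)-u(T)$. For a matroid on ground set $E$ with independent sets $\mathcal{I}$ and weights $w\in\mathbb{R}^E_{\ge 0}$, its weighted rank is $\rho^w(T)=\max\{\sum_{i\in I}w_i: I\in\mathcal{I}, I\subseteq T\}$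 for $T \subseteq E$. $\mathcal{MBV}_{n,n}$ is the smallest subset of $\mathcal{GSV}_n$ that contains the weighted ranks (for all nonnegative weights) of all matroids whose ground set is a subset of $[n]$ and that is closed under merging and endowment. *)

theory Defs
  imports Complex_Main "HOL-Library.FuncSet"
begin

text \<open>
  A set function on the subsets of \<open>E\<close> is a pair of \<open>E\<close> and a function that is
  \<^const>\<open>undefined\<close> outside \<open>Pow E\<close>. Thus two such pairs are equal iff the ground sets
  are equal and the functions agree on all subsets of the ground set.
\<close>

type_synonym setfun = "nat set \<times> (nat set \<Rightarrow> real)"

definition valuation :: "setfun \<Rightarrow> bool" where
  "valuation = (\<lambda>(E, u).
     u \<in> extensional (Pow E) \<and>
     (\<forall>S \<in> Pow E. 0 \<le> u S) \<and>
     u {} = 0 \<and>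
     (\<forall>S T. S \<subseteq> T \<and> T \<subseteq> E \<longrightarrow> u S \<le> u T))"

text \<open>
  A price vector in \<open>\<real>\<^sup>E\<close> is given by any function on \<^typ>\<open>nat\<close>; only its values on \<open>E\<close> are
  used.
\<close>

definition demand :: "setfun \<Rightarrow> (nat \<Rightarrow> real) \<Rightarrow> nat set set" where
  "demand = (\<lambda>(E, u) p. {S. is_arg_max (\<lambda>S. u S - (\<Sum>i\<in>S. p i)) (\<lambda>S. S \<subseteq> E) S})"

definition gross_substitutes :: "setfun \<Rightarrow> bool" where
  "gross_substitutes U \<longleftrightarrow>
     (\<forall>p q. (\<forall>i \<in> fst U. p i \<le> q i) \<longrightarrow>
        (\<forall>S \<in> demand U p. \<exists>T \<in> demand U q. {i \<in> S. p i = q i} \<subseteq> T))"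

definition GSV :: "nat \<Rightarrow> setfun set" where
  "GSV n = {U. fst U \<subseteq> {1..n} \<and> valuation U \<and> gross_substitutes U}"

definition merge :: "setfun \<Rightarrow> setfun \<Rightarrow> setfun" where
  "merge = (\<lambda>(E1, u1) (E2, u2).
     (E1 \<union> E2,
      \<lambda>S \<in> Pow (E1 \<union> E2). Max {u1 T + u2 (S - T) | T. T \<subseteq> S \<inter> E1 \<and> S - T \<subseteq> E2}))"

definition endow :: "nat set \<Rightarrow> setfun \<Rightarrow> setfun" where
  "endow T = (\<lambda>(E, u). (E - T, \<lambda>S \<in> Pow (E - T). u (S \<union> T) - u T))"

definition matroid :: "nat set \<Rightarrow> nat set set \<Rightarrow> bool" where
  "matroid E \<I> \<longleftrightarrow>
     finite E \<and> \<I> \<subseteq> Pow E \<and> {} \<in> \<I> \<and>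
     (\<forall>I J. I \<subseteq> J \<and> J \<in> \<I> \<longrightarrow> I \<in> \<I>) \<and>
     (\<forall>I \<in> \<I>. \<forall>J \<in> \<I>. card I < card J \<longrightarrow> (\<exists>j \<in> J - I. insert j I \<in> \<I>))"

definition weighted_rank :: "nat set \<Rightarrow> nat set set \<Rightarrow> (nat \<Rightarrow> real) \<Rightarrow> setfun" where
  "weighted_rank E \<I> w = (E, \<lambda>T \<in> Pow E. Max {\<Sum>i\<in>I. w i | I. I \<in> \<I> \<and> I \<subseteq> T})"

definition weighted_ranks :: "nat \<Rightarrow> setfun set" where
  "weighted_ranks n =
     {weighted_rank E \<I> w | E \<I> w. matroid E \<I> \<and> E \<subseteq> {1..n} \<and> (\<forall>i \<in> E. 0 \<le> w i)}"

definition merge_closed :: "setfun set \<Rightarrow> bool" where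
  "merge_closed A \<longleftrightarrow> (\<forall>U \<in> A. \<forall>V \<in> A. merge U V \<in> A)"

definition endow_closed :: "setfun set \<Rightarrow> bool" where
  "endow_closed A \<longleftrightarrow> (\<forall>U \<in> A. \<forall>T. T \<subseteq> fst U \<longrightarrow> endow T U \<in> A)"

text \<open>
  \<open>GSV n\<close> is itself a member of the intersected family, because weighted ranks are gross
  substitutes and gross substitutes are closed under both operations. (If the family were
  empty, the intersection would be \<^const>\<open>UNIV\<close>.)
\<close>

definition MBV :: "nat \<Rightarrow> setfun set" where
  "MBV n = \<Inter> {A. A \<subseteq> GSV n \<and> weighted_ranks n \<subseteq> A \<and> merge_closed A \<and> endow_closed A}"

end

theory Submission
  imports Defs
begin

text \<open>
  Gross substitutability of \<open>u\<close> is equivalent to submodularity of the surplus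
  \<open>p \<mapsto> max\<^sub>S (u S - sum p S)\<close>. The ascending auction of Kelso and Crawford shows that the surplus
  of a merge at \<open>p\<close> is the infimum over \<open>q \<ge> p\<close> of the sum of the two surpluses at \<open>q\<close> plus
  \<open>\<Sum>i. q i - p i\<close>; partial minimisation preserves submodularity, so \<open>GSV n\<close> is closed under merging.

  For \<open>n \<ge> 4\<close> split the items into two classes with at least two items each, and let \<open>v\<close> be \<open>2\<close> on
  nonempty sets within one class and \<open>3\<close> on sets that meet both. If \<open>v\<close> is a merge of \<open>u1\<close> and
  \<open>u2\<close>, then one of them, say \<open>u1\<close>, is \<open>2\<close> on all singletons. As every class has two items, \<open>u2\<close>
  vanishes on singletons and hence everywhere, and \<open>u1 = v\<close>. Since \<open>v\<close> is not a weighted rank, \<open>v\<close>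
  can be removed from \<open>GSV n\<close> without destroying the closure properties.

  For \<open>n \<le> 3\<close> every gross substitutes valuation is a merge of three weighted ranks of rank one.
\<close>

section \<open>Exchange properties and weighted ranks\<close>

lemma in_demand_iff:
  "S \<in> demand (E, u) p \<longleftrightarrow> S \<subseteq> E \<and> (\<forall>T. T \<subseteq> E \<longrightarrow> u T - sum p T \<le> u S - sum p S)"
  by (auto simp: demand_def is_arg_max_linorder)

lemma demand_nonempty:
  assumes "finite E"
  shows "\<exists>S. S \<in> demand (E, u) p"
proof -
  let ?f = "\<lambda>S. u S - sum p S"
  have fin: "finite (?f ` Pow E)" and ne: "?f ` Pow E \<noteq> {}"
    using assms by auto
  obtain S where "S \<subseteq> E" and S: "?f S = Max (?f ` Pow E)"
    using Max_in[OF fin ne] by auto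
  moreover have "?f T \<le> ?f S" if "T \<subseteq> E" for T
    using fin that unfolding S by (intro Max_ge) auto
  ultimately show ?thesis
    unfolding in_demand_iff by blast
qed

lemma gross_substitutesE:
  assumes "gross_substitutes (E, u)" "\<And>i. i \<in> E \<Longrightarrow> p i \<le> q i" "S \<in> demand (E, u) p"
  obtains T where "T \<in> demand (E, u) q" "{i \<in> S. p i = q i} \<subseteq> T"
proof -
  have "\<exists>T \<in> demand (E, u) q. {i \<in> S. p i = q i} \<subseteq> T"
    using assms(1)[unfolded gross_substitutes_def, rule_format, of p q S] assms(2,3) by simp
  then show thesis using that by blast
qed

lemma gross_substitutesI:
  assumes "\<And>p q S. (\<And>i. i \<in> E \<Longrightarrow> p i \<le> q i) \<Longrightarrow> S \<in> demand (E, u) p \<Longrightarrow>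
    \<exists>T \<in> demand (E, u) q. {i \<in> S. p i = q i} \<subseteq> T"
  shows "gross_substitutes (E, u)"
  using assms unfolding gross_substitutes_def by auto

text \<open>This is M-natural-concavity for set functions: \<open>i\<close> moves from
  \<open>X\<close> to \<open>Y\<close>, possibly in return for some \<open>j\<close>. It mentions no
  prices, so it can be checked directly for concrete functions.\<close>

definition exchange_property :: "setfun \<Rightarrow> bool" where
  "exchange_property = (\<lambda>(E, u). \<forall>X Y i. X \<subseteq> E \<and> Y \<subseteq> E \<and> i \<in> X - Y \<longrightarrow>
     u X + u Y \<le> u (X - {i}) + u (insert i Y) \<or>
     (\<exists>j \<in> Y - X. u X + u Y \<le> u (insert j (X - {i})) + u (insert i Y - {j})))"

text \<open>Among the sets demanded at \<open>q\<close> take a \<open>T\<close> that contains as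
  many items of \<open>F\<close> as possible. If it misses \<open>f\<close>, exchange
  \<open>f\<close> between \<open>S\<close> and \<open>T\<close>: optimality of \<open>S\<close> at
  \<open>p\<close>, together with \<open>p f = q f\<close> and \<open>p j \<le> q j\<close>, keeps
  the changed \<open>T\<close> optimal at \<open>q\<close>. It gains \<open>f\<close> and loses
  nothing of \<open>F\<close>, since a returned \<open>j\<close> lies outside
  \<open>S\<close>.\<close>

lemma gross_substitutes_if_exchange_property:
  assumes fin: "finite E" and ex: "exchange_property (E, u)"
  shows "gross_substitutes (E, u)"
proof (rule gross_substitutesI)
  fix p q :: "nat \<Rightarrow> real" and S
  assume le: "\<And>i. i \<in> E \<Longrightarrow> p i \<le> q i" and S: "S \<in> demand (E, u) p"
  define F where "F = {i \<in> S. p i = q i}"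
  have SE: "S \<subseteq> E" and Sopt: "\<And>T. T \<subseteq> E \<Longrightarrow> u T - sum p T \<le> u S - sum p S"
    using S by (auto simp: in_demand_iff)
  have finF: "finite F"
    using SE fin finite_subset[of F E] by (auto simp: F_def)
  obtain T0 where T0: "T0 \<in> demand (E, u) q"
    using demand_nonempty[OF fin] by blast
  have "\<forall>T. T \<in> demand (E, u) q \<longrightarrow> card (F \<inter> T) < Suc (card F)"
    using finF by (auto intro!: card_mono simp: less_Suc_eq_le)
  from ex_has_greatest_nat[of "\<lambda>T. T \<in> demand (E, u) q", OF T0 this]
  obtain T where T: "T \<in> demand (E, u) q"
    and Tmax: "\<And>T'. T' \<in> demand (E, u) q \<Longrightarrow> card (F \<inter> T') \<le> card (F \<inter> T)" by blast
  have TE: "T \<subseteq> E" and Topt: "\<And>T'. T' \<subseteq> E \<Longrightarrow> u T' - sum q T' \<le> u T - sum q T"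
    using T by (auto simp: in_demand_iff)
  have finS: "finite S" and finT: "finite T"
    using SE TE fin finite_subset by auto
  have "F \<subseteq> T"
  proof (rule ccontr)
    assume "\<not> F \<subseteq> T"
    then obtain f where f: "f \<in> F" "f \<notin> T" by blast
    then have fS: "f \<in> S" and pq: "p f = q f" by (auto simp: F_def)
    have better: False if "T' \<subseteq> E" "u T - sum q T \<le> u T' - sum q T'" "insert f (F \<inter> T) \<subseteq> F \<inter> T'" for T'
    proof -
      have "T' \<in> demand (E, u) q"
        using that(1,2) Topt unfolding in_demand_iff by (meson order_trans)
      moreover have "card (insert f (F \<inter> T)) \<le> card (F \<inter> T')"
        using finF that(3) by (intro card_mono) auto
      ultimately show False
        using Tmax[of T'] f finF by simp
    qed
    from ex SE TE fS f(2) consider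
      "u S + u T \<le> u (S - {f}) + u (insert f T)"
      | j where "j \<in> T - S" "u S + u T \<le> u (insert j (S - {f})) + u (insert f T - {j})"
      unfolding exchange_property_def by blast
    then show False
    proof cases
      case 1
      have "u (S - {f}) - sum p (S - {f}) \<le> u S - sum p S"
        using SE by (intro Sopt) auto
      then show False
        using 1 f fS finS finT TE SE pq by (intro better[of "insert f T"]) (auto simp: sum_diff1)
    next
      case (2 j)
      have "u (insert j (S - {f})) - sum p (insert j (S - {f})) \<le> u S - sum p S"
        using SE TE 2 by (intro Sopt) auto
      moreover have "p j \<le> q j" using 2 TE le by auto
      moreover have "sum p (insert j (S - {f})) = sum p S - p f + p j"
        using 2 fS finS by (simp add: sum_diff1)
      moreover have "sum q (insert f T - {j}) = sum q T + q f - q j"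
        using 2 f finT by (auto simp: sum_diff1)
      moreover have "j \<notin> F" "f \<noteq> j" using 2 f by (auto simp: F_def)
      ultimately show False
        using 2 f fS TE SE pq by (intro better[of "insert f T - {j}"]) auto
    qed
  qed
  then show "\<exists>T \<in> demand (E, u) q. {i \<in> S. p i = q i} \<subseteq> T"
    using T unfolding F_def by blast
qed

section \<open>Exchange in matroids\<close>

lemma matroid_finite_indep: "matroid E \<I> \<Longrightarrow> I \<in> \<I> \<Longrightarrow> finite I"
  unfolding matroid_def by (auto dest: finite_subset)

lemma matroid_indep_subset: "matroid E \<I> \<Longrightarrow> J \<in> \<I> \<Longrightarrow> I \<subseteq> J \<Longrightarrow> I \<in> \<I>"
  unfolding matroid_def by (elim conjE) metis

lemma matroid_augment:
  assumes M: "matroid E \<I>" and I: "I \<in> \<I>" and J: "J \<in> \<I>" and "card I \<le> card J"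
  shows "\<exists>K \<in> \<I>. I \<subseteq> K \<and> K \<subseteq> I \<union> J \<and> card K = card J"
  using I \<open>card I \<le> card J\<close>
proof (induction "card J - card I" arbitrary: I)
  case 0
  then show ?case by auto
next
  case (Suc k)
  then have "card I < card J" by simp
  then obtain j where j: "j \<in> J - I" "insert j I \<in> \<I>"
    using M J Suc.prems unfolding matroid_def by blast
  have "finite I"
    using matroid_finite_indep[OF M] Suc.prems by blast
  with j have "card (insert j I) = Suc (card I)" by simp
  then obtain K where "K \<in> \<I>" "insert j I \<subseteq> K" "K \<subseteq> insert j I \<union> J" "card K = card J"
    using Suc.hyps(1)[of "insert j I"] Suc.hyps(2) \<open>card I < card J\<close> j by fastforce
  then show ?case using j by blast
qed

text \<open>If both alternatives fail, no item of \<open>K\<close> outside \<open>I\<close> extends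
  \<open>I - {f}\<close>, so \<open>I - {f}\<close> is a largest independent set within
  \<open>?R\<close>. A set \<open>B\<close> of that size containing \<open>K\<close> can then be
  augmented from \<open>I\<close> only by \<open>f\<close>, hence \<open>insert f K\<close> is
  independent. Enlarged to the size of \<open>J\<close> inside \<open>insert f J\<close>, it omits
  some \<open>e\<close> of \<open>J\<close>; but then \<open>e\<close> belongs to
  \<open>K\<close>.\<close>

lemma matroid_simultaneous_exchange:
  assumes M: "matroid E \<I>" and I: "I \<in> \<I>" and J: "J \<in> \<I>" and f: "f \<in> I - J"
  shows "insert f J \<in> \<I> \<or> (\<exists>e \<in> J - I. insert e (I - {f}) \<in> \<I> \<and> insert f J - {e} \<in> \<I>)"
proof (rule ccontr)
  assume not: "\<not> ?thesis"
  have sub: "\<And>A B. A \<subseteq> B \<Longrightarrow> B \<in> \<I> \<Longrightarrow> A \<in> \<I>"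
    using matroid_indep_subset[OF M] by blast
  have aug: "\<And>A B. A \<in> \<I> \<Longrightarrow> B \<in> \<I> \<Longrightarrow> card A < card B \<Longrightarrow> \<exists>j \<in> B - A. insert j A \<in> \<I>"
    using M unfolding matroid_def by blast
  have fin: "\<And>A. A \<in> \<I> \<Longrightarrow> finite A"
    by (rule matroid_finite_indep[OF M])
  \<comment> \<open>\<open>insert f K\<close> is the fundamental circuit of \<open>f\<close> with respect to \<open>J\<close>\<close>
  define K where "K = {e \<in> J. insert f J - {e} \<in> \<I>}"
  let ?R = "(I - {f}) \<union> K"
  have KI: "K \<in> \<I>" using sub[OF _ J] by (auto simp: K_def)
  have I': "I - {f} \<in> \<I>" using sub[OF _ I] by auto
  have small: "card B \<le> card (I - {f})" if "B \<in> \<I>" "B \<subseteq> ?R" for B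
  proof (rule ccontr)
    assume "\<not> ?thesis"
    then obtain j where "j \<in> B - (I - {f})" "insert j (I - {f}) \<in> \<I>"
      using aug[OF I' \<open>B \<in> \<I>\<close>] by auto
    moreover from this have "j \<in> K" "j \<notin> I" using that f by (auto simp: K_def)
    ultimately show False using not by (auto simp: K_def)
  qed
  obtain B where B: "B \<in> \<I>" "K \<subseteq> B" "B \<subseteq> K \<union> (I - {f})" "card B = card (I - {f})"
    using matroid_augment[OF M KI I'] small[OF KI] by auto
  have "card B < card I"
    using B f fin[OF I] card_Diff1_less[of I f] by auto
  then obtain j where j: "j \<in> I - B" "insert j B \<in> \<I>"
    using aug[OF B(1) I] by auto
  have "j = f"
  proof (rule ccontr)
    assume "j \<noteq> f"
    then have "card (insert j B) \<le> card (I - {f})"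
      using j B by (intro small) auto
    then show False using j B(4) fin[OF B(1)] by simp
  qed
  then have fK: "insert f K \<in> \<I>" 
    using j B by (intro sub[of "insert f K" "insert j B"]) auto
  have "K \<noteq> J" using fK not by auto
  then have "card K < card J"
    using fin[OF J] by (intro psubset_card_mono) (auto simp: K_def)
  then have "card (insert f K) \<le> card J"
    using fin[OF KI] f by (auto simp: K_def)
  then obtain L where L: "L \<in> \<I>" "insert f K \<subseteq> L" "L \<subseteq> insert f K \<union> J" "card L = card J"
    using matroid_augment[OF M fK J] by auto
  then have LfJ: "L \<subseteq> insert f J" by (auto simp: K_def)
  have "\<not> J \<subseteq> L"
  proof
    assume "J \<subseteq> L"
    then have "insert f J \<subseteq> L" using L by auto
    then show False using not sub[of "insert f J" L] L(1) by blast
  qed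
  then obtain e where e: "e \<in> J" "e \<notin> L" by blast
  have "insert f J - {e} = L"
    using LfJ L e f fin[OF J] by (intro card_subset_eq[symmetric]) (auto simp: card_Diff_singleton)
  then show False using e L by (auto simp: K_def)
qed

section \<open>Weighted ranks\<close>

lemma weighted_rank_ge:
  assumes "matroid E \<I>" "I \<in> \<I>" "I \<subseteq> T" "T \<subseteq> E"
  shows "sum w I \<le> snd (weighted_rank E \<I> w) T"
proof -
  have "{\<Sum>i\<in>I. w i | I. I \<in> \<I> \<and> I \<subseteq> T} \<subseteq> sum w ` Pow T" by auto
  moreover have "finite (sum w ` Pow T)"
    using assms finite_subset[of T E] unfolding matroid_def by simp
  ultimately have "finite {\<Sum>i\<in>I. w i | I. I \<in> \<I> \<and> I \<subseteq> T}"
    using finite_subset by blast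
  with assms show ?thesis
    unfolding weighted_rank_def by (auto intro!: Max_ge)
qed

lemma weighted_rank_attained:
  assumes "matroid E \<I>" "T \<subseteq> E"
  obtains I where "I \<in> \<I>" "I \<subseteq> T" "snd (weighted_rank E \<I> w) T = sum w I"
proof -
  let ?A = "{\<Sum>i\<in>I. w i | I. I \<in> \<I> \<and> I \<subseteq> T}"
  have "?A \<subseteq> sum w ` Pow T" by auto
  moreover have "finite (sum w ` Pow T)"
    using assms finite_subset[of T E] unfolding matroid_def by simp
  ultimately have "finite ?A"
    using finite_subset by blast
  moreover have "?A \<noteq> {}" using assms by (auto simp: matroid_def)
  ultimately have "Max ?A \<in> ?A" by (rule Max_in)
  with assms that show ?thesis
    unfolding weighted_rank_def by auto
qed

text \<open>Take heaviest independent sets \<open>I\<close> in \<open>X\<close> and \<open>J\<close>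
  in \<open>Y\<close>. Moving \<open>i\<close> is free if \<open>i \<notin> I\<close>; otherwise
  exchange between \<open>I\<close> and \<open>J\<close>. A partner \<open>e\<close> that lies in
  \<open>X\<close> leaves the new \<open>I\<close> inside \<open>X - {i}\<close>, so nothing has to
  be returned; a partner outside \<open>X\<close> serves as \<open>j\<close>.\<close>

lemma exchange_property_weighted_rank:
  assumes M: "matroid E \<I>"
  shows "exchange_property (weighted_rank E \<I> w)"
proof -
  let ?u = "snd (weighted_rank E \<I> w)"
  have "?u X + ?u Y \<le> ?u (X - {i}) + ?u (insert i Y) \<or>
     (\<exists>j \<in> Y - X. ?u X + ?u Y \<le> ?u (insert j (X - {i})) + ?u (insert i Y - {j}))"
    if XY: "X \<subseteq> E" "Y \<subseteq> E" and i: "i \<in> X - Y" for X Y i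
  proof -
    obtain I where I: "I \<in> \<I>" "I \<subseteq> X" "?u X = sum w I"
      by (rule weighted_rank_attained[OF M XY(1), of w])
    obtain J where J: "J \<in> \<I>" "J \<subseteq> Y" "?u Y = sum w J"
      by (rule weighted_rank_attained[OF M XY(2), of w])
    have sub: "\<And>A B. A \<subseteq> B \<Longrightarrow> B \<in> \<I> \<Longrightarrow> A \<in> \<I>"
      using matroid_indep_subset[OF M] by blast
    have fin: "finite I" "finite J"
      using I J matroid_finite_indep[OF M] by auto
    note ge = weighted_rank_ge[OF M, of _ _ w]
    show ?thesis
    proof (cases "i \<in> I")
      case False
      then have "sum w I \<le> ?u (X - {i})" "sum w J \<le> ?u (insert i Y)"
        using I J XY i by (auto intro!: ge)
      then show ?thesis using I J by auto
    next
      case True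
      then have iIJ: "i \<in> I - J" using J i by auto
      from matroid_simultaneous_exchange[OF M I(1) J(1) iIJ] consider
        "insert i J \<in> \<I>" | e where "e \<in> J - I" "insert e (I - {i}) \<in> \<I>" "insert i J - {e} \<in> \<I>"
        by blast
      then show ?thesis
      proof cases
        case 1
        have "sum w (I - {i}) \<le> ?u (X - {i})"
          using I XY by (intro ge sub[OF _ I(1)]) auto
        moreover have "sum w (insert i J) \<le> ?u (insert i Y)"
          using 1 J XY i by (intro ge) auto
        ultimately show ?thesis
          using I J fin iIJ by (auto simp: sum_diff1)
      next
        case (2 e)
        have sums: "sum w (insert e (I - {i})) = sum w I - w i + w e"
          "sum w (insert i J - {e}) = sum w J + w i - w e"
          using 2 fin iIJ by (auto simp: sum_diff1)
        show ?thesis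
        proof (cases "e \<in> X")
          case True
          have "sum w (insert e (I - {i})) \<le> ?u (X - {i})"
            using I XY 2 True iIJ by (intro ge) auto
          moreover have "sum w (insert i J - {e}) \<le> ?u (insert i Y)"
            using 2 J XY i by (intro ge) auto
          ultimately show ?thesis using sums I J by auto
        next
          case False
          have "sum w (insert e (I - {i})) \<le> ?u (insert e (X - {i}))"
            using I J XY 2 by (intro ge) auto
          moreover have "sum w (insert i J - {e}) \<le> ?u (insert i Y - {e})"
            using 2 J XY i by (intro ge) auto
          moreover have "e \<in> Y - X" using False 2 J by auto
          ultimately show ?thesis using sums I J by force
        qed
      qed
    qed
  qed
  then show ?thesis
    unfolding exchange_property_def weighted_rank_def by auto
qed

lemma weighted_rank_in_GSV:
  assumes M: "matroid E \<I>" and E: "E \<subseteq> {1..n}" and w: "\<And>i. i \<in> E \<Longrightarrow> 0 \<le> w i"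
  shows "weighted_rank E \<I> w \<in> GSV n"
proof -
  let ?u = "snd (weighted_rank E \<I> w)"
  have U: "weighted_rank E \<I> w = (E, ?u)" by (simp add: weighted_rank_def)
  have fin: "finite E" using M by (auto simp: matroid_def)
  have mono: "?u S \<le> ?u T" if "S \<subseteq> T" "T \<subseteq> E" for S T
  proof -
    have "S \<subseteq> E" using that by blast
    then obtain I where "I \<in> \<I>" "I \<subseteq> S" "?u S = sum w I"
      by (rule weighted_rank_attained[OF M, of S w])
    then show ?thesis using weighted_rank_ge[OF M, of I T w] that by auto
  qed
  have zero: "?u {} = 0"
    by (rule weighted_rank_attained[OF M, of "{}" w]) auto
  have "0 \<le> ?u S" if "S \<subseteq> E" for S using mono[of "{}" S] that zero by simp
  then have "valuation (E, ?u)"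
    using mono zero by (auto simp: valuation_def weighted_rank_def)
  moreover have "gross_substitutes (E, ?u)"
    using exchange_property_weighted_rank[OF M, of w]
    by (intro gross_substitutes_if_exchange_property[OF fin]) (simp only: U[symmetric])
  ultimately have "(E, ?u) \<in> GSV n" using E by (simp add: GSV_def)
  then show ?thesis by (simp only: U[symmetric])
qed

section \<open>Surplus functions\<close>

text \<open>In economics this is the indirect utility function.\<close>

definition surplus :: "setfun \<Rightarrow> (nat \<Rightarrow> real) \<Rightarrow> real" where
  "surplus = (\<lambda>(E, u) p. Max ((\<lambda>S. u S - sum p S) ` Pow E))"

lemma surplus_ge: "finite E \<Longrightarrow> S \<subseteq> E \<Longrightarrow> u S - sum p S \<le> surplus (E, u) p"
  unfolding surplus_def by (auto intro!: Max_ge)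

lemma surplus_eq:
  assumes "finite E" "S \<in> demand (E, u) p"
  shows "surplus (E, u) p = u S - sum p S"
  using assms unfolding surplus_def in_demand_iff by (auto intro!: Max_eqI)

lemma in_demand_if_surplus_le:
  assumes "finite E" "S \<subseteq> E" "surplus (E, u) p \<le> u S - sum p S"
  shows "S \<in> demand (E, u) p"
  using assms surplus_ge[OF assms(1)] unfolding in_demand_iff by (meson order_trans)

definition submodular_surplus :: "setfun \<Rightarrow> bool" where
  "submodular_surplus U \<longleftrightarrow>
     (\<forall>p q. surplus U (\<lambda>i. min (p i) (q i)) + surplus U (\<lambda>i. max (p i) (q i)) \<le> surplus U p + surplus U q)"

text \<open>Lower the prices on \<open>F\<close> by one. At \<open>p\<close> this raises the surplus
  by at least \<open>card F\<close>, because the demanded \<open>S\<close> contains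
  \<open>F\<close>. Submodularity for \<open>p\<close> and \<open>q'\<close> transfers this gain to
  \<open>q\<close>. A set \<open>T\<close> demanded at \<open>q'\<close> collects only
  \<open>card (F \<inter> T)\<close> of it, so \<open>T\<close> must contain \<open>F\<close> and be
  optimal at \<open>q\<close> already.\<close>

lemma gross_substitutes_if_submodular_surplus:
  assumes fin: "finite E" and sub: "submodular_surplus (E, u)"
  shows "gross_substitutes (E, u)"
proof (rule gross_substitutesI)
  fix p q :: "nat \<Rightarrow> real" and S
  assume le: "\<And>i. i \<in> E \<Longrightarrow> p i \<le> q i" and S: "S \<in> demand (E, u) p"
  define F where "F = {i \<in> S. p i = q i}"
  have SE: "S \<subseteq> E" using S by (simp add: in_demand_iff)
  then have FE: "F \<subseteq> E" and FS: "F \<subseteq> S" by (auto simp: F_def)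
  have finF: "finite F" using FE fin finite_subset by blast
  define q' where "q' = (\<lambda>i. if i \<in> F then q i - 1 else q i)"
  have sum_shift: "sum (\<lambda>i. if i \<in> F then r i - 1 else r i) T = sum r T - card (F \<inter> T)"
    if "T \<subseteq> E" for r :: "nat \<Rightarrow> real" and T
  proof -
    have finT: "finite T" using that fin finite_subset by blast
    have "sum (\<lambda>i. if i \<in> F then r i - 1 else r i) T = sum (\<lambda>i. r i - (if i \<in> F then 1 else 0)) T"
      by (intro sum.cong) auto
    also have "\<dots> = sum r T - (\<Sum>i\<in>T. if i \<in> F then 1 else 0)"
      by (rule sum_subtractf)
    also have "(\<Sum>i\<in>T. if i \<in> F then 1 else 0 :: real) = (\<Sum>i \<in> T \<inter> F. 1)"
      by (rule sum.inter_restrict[symmetric, OF finT])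
    finally show ?thesis by (simp add: Int_commute)
  qed
  obtain T where T: "T \<in> demand (E, u) q'"
    using demand_nonempty[OF fin] by blast
  then have TE: "T \<subseteq> E" by (simp add: in_demand_iff)
  define p' where "p' = (\<lambda>i. if i \<in> F then p i - 1 else p i)"
  have sum_q': "sum q' T = sum q T - card (F \<inter> T)"
    unfolding q'_def by (rule sum_shift[OF TE])
  have cong: "surplus (E, u) r = surplus (E, u) r'" if "\<And>i. i \<in> E \<Longrightarrow> r i = r' i" for r r'
  proof -
    have "sum r S = sum r' S" if "S \<subseteq> E" for S
      using \<open>\<And>i. i \<in> E \<Longrightarrow> r i = r' i\<close> that by (intro sum.cong) auto
    then show ?thesis unfolding surplus_def by (auto intro!: arg_cong[where f = Max])
  qed
  have "surplus (E, u) (\<lambda>i. min (p i) (q' i)) = surplus (E, u) p'"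
    using le by (intro cong) (auto simp: q'_def p'_def F_def)
  moreover have "surplus (E, u) (\<lambda>i. max (p i) (q' i)) = surplus (E, u) q"
    using le by (intro cong) (auto simp: q'_def F_def)
  ultimately have "surplus (E, u) p' + surplus (E, u) q \<le> surplus (E, u) p + surplus (E, u) q'"
    using sub unfolding submodular_surplus_def by metis
  moreover have "surplus (E, u) p + card F \<le> surplus (E, u) p'"
    using surplus_ge[OF fin SE, of u p'] surplus_eq[OF fin S] FS
    unfolding p'_def sum_shift[OF SE] by (simp add: Int_absorb2)
  ultimately have "surplus (E, u) q + card F \<le> surplus (E, u) q'" by simp
  also have "\<dots> = u T - sum q T + card (F \<inter> T)"
    using surplus_eq[OF fin T] sum_q' by simp
  finally have 1: "surplus (E, u) q + card F \<le> u T - sum q T + card (F \<inter> T)" .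
  have 2: "card (F \<inter> T) \<le> card F" using finF by (intro card_mono) auto
  have 3: "u T - sum q T \<le> surplus (E, u) q" by (rule surplus_ge[OF fin TE])
  have "T \<in> demand (E, u) q"
    using 1 2 by (intro in_demand_if_surplus_le[OF fin TE]) simp
  moreover have "card (F \<inter> T) = card F" using 1 2 3 by simp
  then have "F \<inter> T = F" using finF by (intro card_subset_eq) auto
  ultimately show "\<exists>T \<in> demand (E, u) q. {i \<in> S. p i = q i} \<subseteq> T"
    unfolding F_def by blast
qed

text \<open>
  Along the segment from \<open>p\<close> to \<open>p + b\<close> the surplus decreases at the rate \<open>sum b S\<close>, where \<open>S\<close> is
  demanded. Adding \<open>a\<close> to the prices can only raise this rate, since the items with \<open>b i \<noteq> 0\<close>
  stay demanded. The sum over a grid of mesh \<open>1 / N\<close> telescopes up to an error of \<open>sum b E / N\<close>.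
\<close>

lemma surplus_increasing_differences:
  assumes fin: "finite E" and gs: "gross_substitutes (E, u)"
    and a: "\<And>i. i \<in> E \<Longrightarrow> 0 \<le> a i" and b: "\<And>i. i \<in> E \<Longrightarrow> 0 \<le> b i"
    and ab: "\<And>i. i \<in> E \<Longrightarrow> a i = 0 \<or> b i = 0"
  shows "surplus (E, u) p + surplus (E, u) (\<lambda>i. p i + a i + b i)
    \<le> surplus (E, u) (\<lambda>i. p i + a i) + surplus (E, u) (\<lambda>i. p i + b i)"
proof -
  define P where "P t = (\<lambda>i. p i + t * b i)" for t :: real
  define Q where "Q t = (\<lambda>i. p i + a i + t * b i)" for t :: real
  define h where "h t = surplus (E, u) (P t) - surplus (E, u) (Q t)" for t
  define X where "X t = (SOME S. S \<in> demand (E, u) (P t))" for t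
  have X: "X t \<in> demand (E, u) (P t)" for t
    unfolding X_def using demand_nonempty[OF fin] by (rule someI_ex)
  have XE: "X t \<subseteq> E" for t using X by (simp add: in_demand_iff)
  have sumP: "sum (P t) S = sum p S + t * sum b S" for t S
    by (simp add: P_def sum.distrib sum_distrib_left)
  have sumQ: "sum (Q t) S = sum p S + sum a S + t * sum b S" for t S
    by (simp add: Q_def sum.distrib sum_distrib_left)
  have step: "h s - h t \<le> (t - s) * (sum b (X s) - sum b (X t))" if "s \<le> t" for s t
  proof -
    obtain T where T: "T \<in> demand (E, u) (Q t)" and "{i \<in> X t. P t i = Q t i} \<subseteq> T"
      using gross_substitutesE[OF gs _ X[of t], of "Q t"] a by (auto simp: P_def Q_def)
    then have XT: "{i \<in> X t. a i = 0} \<subseteq> T" by (auto simp: P_def Q_def)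
    have TE: "T \<subseteq> E" using T by (simp add: in_demand_iff)
    have finX: "finite (X t)" "finite T" using XE TE fin finite_subset by blast+
    \<comment> \<open>Items with \<open>a i \<noteq> 0\<close> have \<open>b i = 0\<close> and
      contribute nothing.\<close>
    have "sum b (X t) = sum b {i \<in> X t. a i = 0}"
      using finX ab XE[of t] by (intro sum.mono_neutral_right) auto
    also have "\<dots> \<le> sum b T"
      using finX XT b TE by (intro sum_mono2) auto
    finally have bT: "(t - s) * sum b (X t) \<le> (t - s) * sum b T"
      using that by (intro mult_left_mono) auto
    \<comment> \<open>A set demanded at one end of the segment is tested at the other end:
      \<open>T\<close> at \<open>Q s\<close>, and \<open>X s\<close> at \<open>P t\<close>.\<close>
    have "surplus (E, u) (Q t) = u T - sum (Q t) T" "surplus (E, u) (Q s) \<ge> u T - sum (Q s) T"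
      using surplus_eq[OF fin T] surplus_ge[OF fin TE] by auto
    moreover have "surplus (E, u) (P s) = u (X s) - sum (P s) (X s)"
      "surplus (E, u) (P t) \<ge> u (X s) - sum (P t) (X s)"
      by (rule surplus_eq[OF fin X], rule surplus_ge[OF fin XE])
    ultimately show ?thesis
      using bT unfolding h_def sumP sumQ by (simp add: algebra_simps)
  qed
  have grid: "h 0 - h (real k / N) \<le> (sum b (X 0) - sum b (X (real k / N))) / N"
    if "N > 0" for k and N :: nat
  proof (induction k)
    case 0
    then show ?case by simp
  next
    case (Suc k)
    have "real (Suc k) / N - real k / N = 1 / N" by (simp add: diff_divide_distrib[symmetric])
    moreover have "real k / N \<le> real (Suc k) / N" by (simp add: divide_right_mono)
    ultimately have "h (real k / N) - h (real (Suc k) / N)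
        \<le> (sum b (X (real k / N)) - sum b (X (real (Suc k) / N))) / N"
      using step[of "real k / N" "real (Suc k) / N"] by simp
    with Suc show ?case by (simp add: diff_divide_distrib)
  qed
  have "h 0 - h 1 \<le> e" if "e > 0" for e
  proof -
    obtain N where N: "N > 0" "sum b E / e < real N"
      using reals_Archimedean2[of "max 0 (sum b E / e)"] by force
    have "h 0 - h 1 \<le> (sum b (X 0) - sum b (X 1)) / N"
      using grid[of N N] N by simp
    also have "\<dots> \<le> sum b E / N"
    proof (rule divide_right_mono)
      have "sum b (X 0) \<le> sum b E" using fin XE b by (intro sum_mono2) auto
      moreover have "0 \<le> sum b (X 1)" using b XE by (intro sum_nonneg) auto
      ultimately show "sum b (X 0) - sum b (X 1) \<le> sum b E" by simp
    qed simp
    also have "\<dots> \<le> e" using N that by (simp add: field_simps)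
    finally show ?thesis .
  qed
  then have "h 0 - h 1 \<le> 0" by - (rule field_le_epsilon, simp)
  then show ?thesis unfolding h_def P_def Q_def by simp
qed

text \<open>Seen from \<open>?m\<close>, the increments to \<open>p\<close> and to \<open>q\<close>
  have disjoint supports, and adding both leads to the maximum.\<close>

lemma submodular_surplus_if_gross_substitutes:
  assumes "finite E" "gross_substitutes (E, u)"
  shows "submodular_surplus (E, u)"
  unfolding submodular_surplus_def
proof (intro allI)
  fix p q :: "nat \<Rightarrow> real"
  let ?m = "\<lambda>i. min (p i) (q i)"
  have "(\<lambda>i. ?m i + (p i - ?m i)) = p" "(\<lambda>i. ?m i + (q i - ?m i)) = q"
    "(\<lambda>i. ?m i + (p i - ?m i) + (q i - ?m i)) = (\<lambda>i. max (p i) (q i))"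
    by (auto simp: min_def max_def)
  then show "surplus (E, u) ?m + surplus (E, u) (\<lambda>i. max (p i) (q i))
      \<le> surplus (E, u) p + surplus (E, u) q"
    using surplus_increasing_differences[OF assms, of "\<lambda>i. p i - ?m i" "\<lambda>i. q i - ?m i" ?m]
    by (auto simp: min_def)
qed

section \<open>Closure under merging and endowment\<close>

definition bidder_price :: "(nat \<Rightarrow> real) \<Rightarrow> real \<Rightarrow> (nat \<Rightarrow> nat) \<Rightarrow> nat set \<Rightarrow> nat \<Rightarrow> real" where
  "bidder_price p \<epsilon> m S i = p i + \<epsilon> * m i + (if i \<in> S then 0 else \<epsilon>)"

text \<open>
  States of the ascending auction of Kelso and Crawford: item \<open>i\<close> received \<open>m i\<close> bids and has
  price \<open>p i + \<epsilon> * m i\<close>; the bidders hold \<open>S1\<close> and \<open>S2\<close> and outbid the holder of an item by \<open>\<epsilon>\<close>.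
\<close>

definition auction_state ::
  "setfun \<Rightarrow> setfun \<Rightarrow> (nat \<Rightarrow> real) \<Rightarrow> real \<Rightarrow> nat \<Rightarrow> (nat \<Rightarrow> nat) \<Rightarrow> nat set \<Rightarrow> nat set \<Rightarrow> bool" where
  "auction_state U1 U2 p \<epsilon> K m S1 S2 \<longleftrightarrow>
     S1 \<subseteq> fst U1 \<and> S2 \<subseteq> fst U2 \<and> S1 \<inter> S2 = {} \<and> (\<forall>i \<in> fst U1 \<union> fst U2. m i \<le> K) \<and>
     (\<forall>i \<in> fst U1 \<union> fst U2 - (S1 \<union> S2). m i = 0) \<and>
     (\<exists>D \<in> demand U1 (bidder_price p \<epsilon> m S1). S1 \<subseteq> D) \<and>
     (\<exists>D \<in> demand U2 (bidder_price p \<epsilon> m S2). S2 \<subseteq> D)"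

lemma auction_state_commute:
  "auction_state U1 U2 p \<epsilon> K m S1 S2 \<longleftrightarrow> auction_state U2 U1 p \<epsilon> K m S2 S1"
  unfolding auction_state_def Un_commute[of "fst U1"] Un_commute[of S1] Int_commute[of S1] by argo

lemma valuation_mono: "valuation (E, u) \<Longrightarrow> S \<subseteq> T \<Longrightarrow> T \<subseteq> E \<Longrightarrow> u S \<le> u T"
  unfolding valuation_def by auto

lemma valuation_nonneg: "valuation (E, u) \<Longrightarrow> S \<subseteq> E \<Longrightarrow> 0 \<le> u S"
  unfolding valuation_def by auto

lemma valuation_empty: "valuation (E, u) \<Longrightarrow> u {} = 0"
  unfolding valuation_def by auto

text \<open>The first bidder takes all of \<open>D\<close>. Each newly taken item receives one bid,
  so the prices he faces stay the same. For the second bidder prices rise only on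
  \<open>D - S1\<close>, hence substitutability lets him keep \<open>S2 - D\<close>.\<close>

lemma auction_step:
  assumes fin: "finite E1" "finite E2" and val: "valuation (E1, u1)"
    and gs: "gross_substitutes (E2, u2)" and \<epsilon>: "\<epsilon> > 0"
    and K: "\<And>i. i \<in> E1 \<union> E2 \<Longrightarrow> u1 E1 \<le> p i + \<epsilon> * real K"
    and st: "auction_state (E1, u1) (E2, u2) p \<epsilon> K m S1 S2"
    and D: "D \<in> demand (E1, u1) (bidder_price p \<epsilon> m S1)" "S1 \<subset> D"
  shows "\<exists>m' S1' S2'. auction_state (E1, u1) (E2, u2) p \<epsilon> K m' S1' S2' \<and>
    sum m (E1 \<union> E2) < sum m' (E1 \<union> E2)"
proof -
  have S: "S1 \<subseteq> E1" "S2 \<subseteq> E2" "S1 \<inter> S2 = {}"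
    and mK: "\<And>i. i \<in> E1 \<union> E2 \<Longrightarrow> m i \<le> K"
    and free: "\<And>i. i \<in> E1 \<union> E2 - (S1 \<union> S2) \<Longrightarrow> m i = 0"
    using st unfolding auction_state_def fst_conv by blast+
  from st obtain D2 where D2: "D2 \<in> demand (E2, u2) (bidder_price p \<epsilon> m S2)" "S2 \<subseteq> D2"
    unfolding auction_state_def by blast
  have DE: "D \<subseteq> E1" using D by (simp add: in_demand_iff)
  define m' where "m' = (\<lambda>i. if i \<in> D - S1 then Suc (m i) else m i)"
  have price1: "bidder_price p \<epsilon> m' D = bidder_price p \<epsilon> m S1"
    using D(2) by (intro ext) (auto simp: bidder_price_def m'_def algebra_simps)
  have "bidder_price p \<epsilon> m S2 i \<le> bidder_price p \<epsilon> m' (S2 - D) i" for i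
    using \<epsilon> by (auto simp: bidder_price_def m'_def algebra_simps)
  then obtain T where T: "T \<in> demand (E2, u2) (bidder_price p \<epsilon> m' (S2 - D))"
    "{i \<in> D2. bidder_price p \<epsilon> m S2 i = bidder_price p \<epsilon> m' (S2 - D) i} \<subseteq> T"
    using gross_substitutesE[OF gs _ D2(1), of "bidder_price p \<epsilon> m' (S2 - D)"] by blast
  have "S2 - D \<subseteq> {i \<in> D2. bidder_price p \<epsilon> m S2 i = bidder_price p \<epsilon> m' (S2 - D) i}"
    using D2 by (auto simp: bidder_price_def m'_def)
  with T have T2: "S2 - D \<subseteq> T" by blast
  \<comment> \<open>As \<open>i\<close> is not held, \<open>bidder_price\<close> already includes
    the next increment. It is at most the marginal value of \<open>i\<close> in \<open>D\<close>,
    hence at most \<open>u1 E1\<close>.\<close>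
  have bound: "Suc (m i) \<le> K" if i: "i \<in> D - S1" for i
  proof -
    have finD: "finite D" using DE fin finite_subset by blast
    have "u1 (D - {i}) - sum (bidder_price p \<epsilon> m S1) (D - {i})
        \<le> u1 D - sum (bidder_price p \<epsilon> m S1) D"
      using D DE unfolding in_demand_iff by blast
    then have "bidder_price p \<epsilon> m S1 i \<le> u1 D - u1 (D - {i})"
      using i finD by (simp add: sum_diff1)
    also have "\<dots> \<le> u1 D" using valuation_nonneg[OF val, of "D - {i}"] DE by auto
    also have "\<dots> \<le> u1 E1" using valuation_mono[OF val] DE by auto
    also have "\<dots> \<le> p i + \<epsilon> * real K" using K i DE by blast
    finally have "\<epsilon> * real (Suc (m i)) \<le> \<epsilon> * real K"
      using i by (simp add: bidder_price_def algebra_simps)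
    then show ?thesis using \<epsilon> by simp
  qed
  have "auction_state (E1, u1) (E2, u2) p \<epsilon> K m' D (S2 - D)"
    unfolding auction_state_def fst_conv
  proof (intro conjI ballI)
    show "\<exists>Da\<in>demand (E1, u1) (bidder_price p \<epsilon> m' D). D \<subseteq> Da"
      unfolding price1 using D by blast
    show "\<exists>D'\<in>demand (E2, u2) (bidder_price p \<epsilon> m' (S2 - D)). S2 - D \<subseteq> D'"
      using T T2 by blast
    show "m' i \<le> K" if "i \<in> E1 \<union> E2" for i
      using bound mK that by (auto simp: m'_def)
    show "m' i = 0" if "i \<in> E1 \<union> E2 - (D \<union> (S2 - D))" for i
    proof -
      have "i \<in> E1 \<union> E2 - (S1 \<union> S2)" "i \<notin> D" using that D(2) by blast+
      then show ?thesis using free by (simp add: m'_def)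
    qed
  qed (use DE S in auto)
  moreover have "sum m (E1 \<union> E2) < sum m' (E1 \<union> E2)"
  proof -
    obtain i where "i \<in> D - S1" using D(2) by blast
    then show ?thesis
      using fin DE by (intro sum_strict_mono_ex1) (auto simp: m'_def intro!: bexI[of _ i])
  qed
  ultimately show ?thesis by blast
qed

text \<open>Take a state with the largest total number of bids, which exists as each
  \<open>m i\<close> is at most \<open>K\<close>. By \<open>auction_step\<close> no demanded set
  properly contains a holding, so both holdings are themselves demanded.\<close>

lemma auction_terminates:
  assumes fin: "finite E1" "finite E2" and val: "valuation (E1, u1)" "valuation (E2, u2)"
    and gs: "gross_substitutes (E1, u1)" "gross_substitutes (E2, u2)" and \<epsilon>: "\<epsilon> > 0"
  obtains S1 S2 q where "S1 \<inter> S2 = {}"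
    "\<forall>i \<in> E1 \<union> E2. p i \<le> q i" "\<forall>i \<in> E1 \<union> E2 - (S1 \<union> S2). q i = p i"
    "S1 \<in> demand (E1, u1) (\<lambda>i. if i \<in> S1 then q i else q i + \<epsilon>)"
    "S2 \<in> demand (E2, u2) (\<lambda>i. if i \<in> S2 then q i else q i + \<epsilon>)"
proof -
  \<comment> \<open>After \<open>B\<close> increments every item costs at least
    \<open>u1 E1 + u2 E2\<close>. The element \<open>0\<close> keeps \<open>Max\<close> meaningful
    when there are no items.\<close>
  define B where "B = Max (insert 0 ((\<lambda>i. (u1 E1 + u2 E2 - p i) / \<epsilon>) ` (E1 \<union> E2)))"
  define K where "K = nat \<lceil>B\<rceil>"
  have K: "u1 E1 + u2 E2 \<le> p i + \<epsilon> * real K" if "i \<in> E1 \<union> E2" for i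
  proof -
    have "(u1 E1 + u2 E2 - p i) / \<epsilon> \<le> B"
      unfolding B_def using fin that by (intro Max_ge) auto
    also have "B \<le> real K" unfolding K_def by linarith
    finally show ?thesis using \<epsilon> by (simp add: field_simps)
  qed
  have nonneg: "0 \<le> u1 E1" "0 \<le> u2 E2"
    using val valuation_nonneg by blast+
  let ?P = "\<lambda>(m, S1, S2). auction_state (E1, u1) (E2, u2) p \<epsilon> K m S1 S2"
  let ?f = "\<lambda>(m, S1 :: nat set, S2 :: nat set). sum m (E1 \<union> E2)"
  have "?P (\<lambda>_. 0, {}, {})"
    using demand_nonempty[OF fin(1)] demand_nonempty[OF fin(2)] by (auto simp: auction_state_def)
  moreover have "\<forall>s. ?P s \<longrightarrow> ?f s < Suc (card (E1 \<union> E2) * K)"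
  proof (intro allI impI)
    fix s assume "?P s"
    then have "fst s i \<le> K" if "i \<in> E1 \<union> E2" for i
      using that by (auto simp: auction_state_def)
    from sum_bounded_above[OF this, of "E1 \<union> E2"] show "?f s < Suc (card (E1 \<union> E2) * K)"
      by (auto simp: less_Suc_eq_le split: prod.splits)
  qed
  ultimately obtain s where "?P s" and smax: "\<And>s'. ?P s' \<Longrightarrow> ?f s' \<le> ?f s"
    using ex_has_greatest_nat[of ?P _ ?f] by blast
  obtain m S1 S2 where s: "s = (m, S1, S2)" by (cases s)
  have st: "auction_state (E1, u1) (E2, u2) p \<epsilon> K m S1 S2"
    using \<open>?P s\<close> s by simp
  have max: "sum m' (E1 \<union> E2) \<le> sum m (E1 \<union> E2)"
    if "auction_state (E1, u1) (E2, u2) p \<epsilon> K m' S1' S2'" for m' S1' S2'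
    using smax[of "(m', S1', S2')"] that s by simp
  have 1: "S1 \<in> demand (E1, u1) (bidder_price p \<epsilon> m S1)"
  proof (rule ccontr)
    assume not: "\<not> ?thesis"
    obtain D where D: "D \<in> demand (E1, u1) (bidder_price p \<epsilon> m S1)" "S1 \<subseteq> D"
      using st unfolding auction_state_def by blast
    then have "S1 \<subset> D" using not by blast
    moreover have "u1 E1 \<le> p i + \<epsilon> * real K" if "i \<in> E1 \<union> E2" for i
      using K[OF that] nonneg by simp
    ultimately show False
      using auction_step[OF fin val(1) gs(2) \<epsilon> _ st D(1)] max by (meson not_less)
  qed
  have 2: "S2 \<in> demand (E2, u2) (bidder_price p \<epsilon> m S2)"
  proof (rule ccontr)
    assume not: "\<not> ?thesis"
    obtain D where D: "D \<in> demand (E2, u2) (bidder_price p \<epsilon> m S2)" "S2 \<subseteq> D"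
      using st unfolding auction_state_def by blast
    then have "S2 \<subset> D" using not by blast
    moreover have "u2 E2 \<le> p i + \<epsilon> * real K" if "i \<in> E2 \<union> E1" for i
      using K[of i] that nonneg by auto
    ultimately obtain m' S1' S2' where
      "auction_state (E2, u2) (E1, u1) p \<epsilon> K m' S2' S1'" "sum m (E2 \<union> E1) < sum m' (E2 \<union> E1)"
      using auction_step[OF fin(2,1) val(2) gs(1) \<epsilon> _ st[unfolded auction_state_commute[of "(E1, u1)"]] D(1)]
      by blast
    then show False
      using max by (metis Un_commute auction_state_commute not_less)
  qed
  define q where "q = (\<lambda>i. p i + \<epsilon> * m i)"
  have price: "bidder_price p \<epsilon> m S = (\<lambda>i. if i \<in> S then q i else q i + \<epsilon>)" for S
    by (auto simp: bidder_price_def q_def)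
  show thesis
  proof (rule that[of S1 S2 q])
    show "S1 \<inter> S2 = {}" using st by (simp add: auction_state_def)
    show "\<forall>i \<in> E1 \<union> E2. p i \<le> q i" using \<epsilon> by (simp add: q_def)
    show "\<forall>i \<in> E1 \<union> E2 - (S1 \<union> S2). q i = p i"
      using st by (auto simp: auction_state_def q_def)
  qed (use 1 2 in \<open>simp_all add: price\<close>)
qed

section \<open>Merging as a maximum over disjoint pairs, and its duality\<close>

lemma merge_ge:
  assumes "finite E1" "finite E2" "T \<subseteq> E1" "R \<subseteq> E2" "T \<inter> R = {}"
  shows "u1 T + u2 R \<le> snd (merge (E1, u1) (E2, u2)) (T \<union> R)"
proof -
  let ?A = "{u1 A + u2 (T \<union> R - A) | A. A \<subseteq> (T \<union> R) \<inter> E1 \<and> T \<union> R - A \<subseteq> E2}"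
  have "?A \<subseteq> (\<lambda>A. u1 A + u2 (T \<union> R - A)) ` Pow E1" by auto
  then have "finite ?A" using assms(1) finite_subset by blast
  moreover have "T \<union> R - T = R" using assms(5) by auto
  then have "u1 T + u2 R \<in> ?A"
    using assms by (intro CollectI exI[of _ T]) auto
  ultimately have "u1 T + u2 R \<le> Max ?A" by (rule Max_ge)
  then show ?thesis using assms unfolding merge_def by auto
qed

lemma merge_attained:
  assumes "finite E1" "finite E2" "S \<subseteq> E1 \<union> E2"
  obtains T R where "T \<subseteq> E1" "R \<subseteq> E2" "T \<inter> R = {}" "T \<union> R = S"
    "snd (merge (E1, u1) (E2, u2)) S = u1 T + u2 R"
proof -
  let ?A = "{u1 A + u2 (S - A) | A. A \<subseteq> S \<inter> E1 \<and> S - A \<subseteq> E2}"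
  have "?A \<subseteq> (\<lambda>A. u1 A + u2 (S - A)) ` Pow E1" by auto
  then have "finite ?A" using assms(1) finite_subset by blast
  moreover have "u1 (S \<inter> E1) + u2 (S - S \<inter> E1) \<in> ?A" using assms(3) by blast
  ultimately have "Max ?A \<in> ?A" by (intro Max_in) auto
  then obtain A where "A \<subseteq> S \<inter> E1" "S - A \<subseteq> E2" "Max ?A = u1 A + u2 (S - A)" by blast
  with assms show ?thesis
    by (intro that[of A "S - A"]) (auto simp: merge_def)
qed

lemma fst_merge [simp]: "fst (merge U V) = fst U \<union> fst V"
  by (simp add: merge_def split: prod.splits)

lemma valuation_merge:
  assumes fin: "finite E1" "finite E2" and val: "valuation (E1, u1)" "valuation (E2, u2)"
  shows "valuation (merge (E1, u1) (E2, u2))"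
proof -
  let ?v = "snd (merge (E1, u1) (E2, u2))"
  have mono: "?v S \<le> ?v S'" if "S \<subseteq> S'" "S' \<subseteq> E1 \<union> E2" for S S'
  proof -
    have "S \<subseteq> E1 \<union> E2" using that by blast
    then obtain T R where TR: "T \<subseteq> E1" "R \<subseteq> E2" "T \<inter> R = {}" "T \<union> R = S" "?v S = u1 T + u2 R"
      by (rule merge_attained[OF fin, of S u1 u2])
    \<comment> \<open>The additional items go to the first valuation where possible, the others to
      the second.\<close>
    let ?T = "T \<union> (S' - S) \<inter> E1" and ?R = "R \<union> (S' - S) \<inter> (E2 - E1)"
    have "u1 T \<le> u1 ?T" "u2 R \<le> u2 ?R"
      using TR by (auto intro!: valuation_mono[OF val(1)] valuation_mono[OF val(2)])
    moreover have "?T \<union> ?R = S'" using TR that by blast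
    then have "u1 ?T + u2 ?R \<le> ?v S'"
      using merge_ge[OF fin, of ?T ?R u1 u2] TR by fastforce
    ultimately show ?thesis using TR by simp
  qed
  have zero: "?v {} = 0"
    by (rule merge_attained[OF fin, of "{}" u1 u2]) (use valuation_empty[OF val(1)] valuation_empty[OF val(2)] in auto)
  have "0 \<le> ?v S" if "S \<subseteq> E1 \<union> E2" for S using mono[of "{}" S] that zero by simp
  moreover have "?v \<in> extensional (Pow (E1 \<union> E2))" by (simp add: merge_def)
  ultimately have "valuation (E1 \<union> E2, ?v)"
    using mono zero by (auto simp: valuation_def)
  then show ?thesis by (simp add: merge_def)
qed

text \<open>Weak duality: split a demanded set of the merge between the two valuations and charge
  \<open>q\<close>. The items left over only add nonnegative terms \<open>q i - p i\<close>.\<close>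

lemma surplus_merge_le:
  assumes fin: "finite E1" "finite E2" and le: "\<And>i. i \<in> E1 \<union> E2 \<Longrightarrow> p i \<le> q i"
  shows "surplus (merge (E1, u1) (E2, u2)) p
    \<le> surplus (E1, u1) q + surplus (E2, u2) q + (\<Sum>i\<in>E1 \<union> E2. q i - p i)"
proof -
  let ?M = "merge (E1, u1) (E2, u2)"
  have M: "?M = (E1 \<union> E2, snd ?M)" by (simp add: merge_def)
  have finN: "finite (E1 \<union> E2)" using fin by simp
  obtain S where S: "S \<in> demand (E1 \<union> E2, snd ?M) p"
    using demand_nonempty[OF finN] by blast
  then have "S \<subseteq> E1 \<union> E2" by (simp add: in_demand_iff)
  then obtain T R where TR: "T \<subseteq> E1" "R \<subseteq> E2" "T \<inter> R = {}" "T \<union> R = S" "snd ?M S = u1 T + u2 R"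
    by (rule merge_attained[OF fin, of S u1 u2])
  have finTR: "finite T" "finite R" using TR fin finite_subset by blast+
  have "surplus ?M p = snd ?M S - sum p S"
    using surplus_eq[OF finN S] by (simp only: M[symmetric])
  also have "\<dots> = (u1 T - sum q T) + (u2 R - sum q R) + (\<Sum>i\<in>S. q i - p i)"
    using TR finTR sum.union_disjoint[of T R q] by (auto simp: sum_subtractf)
  also have "(\<Sum>i\<in>S. q i - p i) \<le> (\<Sum>i\<in>E1 \<union> E2. q i - p i)"
    using finN le \<open>S \<subseteq> E1 \<union> E2\<close> by (intro sum_mono2) auto
  also have "u1 T - sum q T \<le> surplus (E1, u1) q" by (rule surplus_ge[OF fin(1) TR(1)])
  also have "u2 R - sum q R \<le> surplus (E2, u2) q" by (rule surplus_ge[OF fin(2) TR(2)])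
  finally show ?thesis by simp
qed

text \<open>Strong duality up to \<open>\<delta>\<close>, with \<open>q\<close> the final prices of
  the auction. Each holding is optimal at \<open>q\<close> up to \<open>\<epsilon>\<close> per item,
  and items held by nobody satisfy \<open>q i = p i\<close>, so the sum of \<open>q i - p i\<close>
  is exactly what the holders pay above \<open>p\<close>.\<close>

lemma surplus_merge_approx:
  assumes fin: "finite E1" "finite E2" and val: "valuation (E1, u1)" "valuation (E2, u2)"
    and gs: "gross_substitutes (E1, u1)" "gross_substitutes (E2, u2)" and \<delta>: "\<delta> > 0"
  obtains q where "\<forall>i \<in> E1 \<union> E2. p i \<le> q i"
    "surplus (E1, u1) q + surplus (E2, u2) q + (\<Sum>i\<in>E1 \<union> E2. q i - p i)
      \<le> surplus (merge (E1, u1) (E2, u2)) p + \<delta>"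
proof -
  let ?M = "merge (E1, u1) (E2, u2)"
  have M: "?M = (E1 \<union> E2, snd ?M)" by (simp add: merge_def)
  have finN: "finite (E1 \<union> E2)" using fin by simp
  \<comment> \<open>The summand \<open>1\<close> avoids division by zero when both ground sets are
    empty.\<close>
  define c where "c = real (card E1 + card E2 + 1)"
  define \<epsilon> where "\<epsilon> = \<delta> / c"
  have \<epsilon>: "\<epsilon> > 0" using \<delta> by (simp add: \<epsilon>_def c_def)
  obtain S1 S2 q where disj: "S1 \<inter> S2 = {}"
    and le: "\<forall>i \<in> E1 \<union> E2. p i \<le> q i" and free: "\<forall>i \<in> E1 \<union> E2 - (S1 \<union> S2). q i = p i"
    and S1: "S1 \<in> demand (E1, u1) (\<lambda>i. if i \<in> S1 then q i else q i + \<epsilon>)"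
    and S2: "S2 \<in> demand (E2, u2) (\<lambda>i. if i \<in> S2 then q i else q i + \<epsilon>)"
    by (rule auction_terminates[OF fin val gs \<epsilon>, where p = p])
  have approx: "surplus (E, u) q \<le> u S - sum q S + \<epsilon> * card E"
    if finE: "finite E" and S: "S \<in> demand (E, u) (\<lambda>i. if i \<in> S then q i else q i + \<epsilon>)" for E u S
  proof -
    let ?q = "\<lambda>i. if i \<in> S then q i else q i + \<epsilon>"
    obtain T where T: "T \<in> demand (E, u) q" using demand_nonempty[OF finE] by blast
    then have TE: "T \<subseteq> E" by (simp add: in_demand_iff)
    have "surplus (E, u) q = u T - sum q T" by (rule surplus_eq[OF finE T])
    also have "\<dots> \<le> u T - sum ?q T + \<epsilon> * card T"
    proof -
      have "sum ?q T \<le> (\<Sum>i\<in>T. q i + \<epsilon>)" using \<epsilon> by (intro sum_mono) auto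
      then show ?thesis by (simp add: sum.distrib mult.commute)
    qed
    also have "u T - sum ?q T \<le> u S - sum ?q S"
      using S TE by (simp add: in_demand_iff)
    also have "sum ?q S = sum q S" by (intro sum.cong) auto
    also have "\<epsilon> * card T \<le> \<epsilon> * card E"
      using \<epsilon> card_mono[OF finE TE] by (intro mult_left_mono) auto
    finally show ?thesis by simp
  qed
  have SE: "S1 \<subseteq> E1" "S2 \<subseteq> E2" using S1 S2 by (simp_all add: in_demand_iff)
  then have finS: "finite S1" "finite S2" using fin finite_subset by blast+
  have "(\<Sum>i\<in>E1 \<union> E2. q i - p i) = (\<Sum>i\<in>S1 \<union> S2. q i - p i)"
    using finN SE free by (intro sum.mono_neutral_right) auto
  also have "\<dots> = sum q S1 + sum q S2 - sum p (S1 \<union> S2)"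
    using finS disj by (simp add: sum_subtractf sum.union_disjoint)
  finally have "surplus (E1, u1) q + surplus (E2, u2) q + (\<Sum>i\<in>E1 \<union> E2. q i - p i)
      \<le> (u1 S1 + u2 S2) - sum p (S1 \<union> S2) + \<epsilon> * (card E1 + card E2)"
    using approx[OF fin(1) S1] approx[OF fin(2) S2] by (simp add: distrib_left)
  also have "u1 S1 + u2 S2 \<le> snd ?M (S1 \<union> S2)"
    by (rule merge_ge[OF fin SE disj])
  also have "snd ?M (S1 \<union> S2) - sum p (S1 \<union> S2) \<le> surplus ?M p"
    using surplus_ge[OF finN, of "S1 \<union> S2" "snd ?M" p] SE by (simp only: M[symmetric]) blast
  also have "\<epsilon> * (card E1 + card E2) \<le> \<epsilon> * c"
    using \<epsilon> by (intro mult_left_mono) (auto simp: c_def)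
  also have "\<epsilon> * c = \<delta>" by (simp add: \<epsilon>_def c_def)
  finally show thesis using that le by simp
qed

text \<open>For near-optimal dual prices \<open>q\<close> of \<open>p\<close> and \<open>q'\<close>
  of \<open>p'\<close>, the minimum and maximum of \<open>q\<close> and \<open>q'\<close> are
  admissible for those of \<open>p\<close> and \<open>p'\<close>. The linear terms balance exactly
  and \<open>L\<close> is submodular. Each dual price vector costs an error
  \<open>\<delta> / 2\<close>, with \<open>\<delta>\<close> arbitrarily small.\<close>

lemma gross_substitutes_merge:
  assumes fin: "finite E1" "finite E2" and val: "valuation (E1, u1)" "valuation (E2, u2)"
    and gs: "gross_substitutes (E1, u1)" "gross_substitutes (E2, u2)"
  shows "gross_substitutes (merge (E1, u1) (E2, u2))"
proof -
  let ?M = "merge (E1, u1) (E2, u2)" and ?N = "E1 \<union> E2"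
  define L where "L q = surplus (E1, u1) q + surplus (E2, u2) q" for q
  note submod = submodular_surplus_if_gross_substitutes[unfolded submodular_surplus_def, rule_format]
  have L_submodular: "L (\<lambda>i. min (q i) (q' i)) + L (\<lambda>i. max (q i) (q' i)) \<le> L q + L q'" for q q'
    using submod[OF fin(1) gs(1), of q q'] submod[OF fin(2) gs(2), of q q']
    unfolding L_def by simp
  have "surplus ?M (\<lambda>i. min (p i) (p' i)) + surplus ?M (\<lambda>i. max (p i) (p' i))
      \<le> surplus ?M p + surplus ?M p' + \<delta>" if "\<delta> > 0" for p p' \<delta>
  proof -
    have "\<delta> / 2 > 0" using that by simp
    note approx = surplus_merge_approx[OF fin val gs this]
    obtain q where q: "\<forall>i \<in> ?N. p i \<le> q i"
      "L q + (\<Sum>i\<in>?N. q i - p i) \<le> surplus ?M p + \<delta> / 2"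
      unfolding L_def by (rule approx[where p = p])
    obtain q' where q': "\<forall>i \<in> ?N. p' i \<le> q' i"
      "L q' + (\<Sum>i\<in>?N. q' i - p' i) \<le> surplus ?M p' + \<delta> / 2"
      unfolding L_def by (rule approx[where p = p'])
    have "surplus ?M (\<lambda>i. min (p i) (p' i))
        \<le> L (\<lambda>i. min (q i) (q' i)) + (\<Sum>i\<in>?N. min (q i) (q' i) - min (p i) (p' i))"
      unfolding L_def using q(1) q'(1) by (intro surplus_merge_le[OF fin]) (metis min.mono)
    moreover have "surplus ?M (\<lambda>i. max (p i) (p' i))
        \<le> L (\<lambda>i. max (q i) (q' i)) + (\<Sum>i\<in>?N. max (q i) (q' i) - max (p i) (p' i))"
      unfolding L_def using q(1) q'(1) by (intro surplus_merge_le[OF fin]) (metis max.mono)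
    moreover have "(\<Sum>i\<in>?N. min (q i) (q' i) - min (p i) (p' i)) +
        (\<Sum>i\<in>?N. max (q i) (q' i) - max (p i) (p' i)) =
        (\<Sum>i\<in>?N. q i - p i) + (\<Sum>i\<in>?N. q' i - p' i)"
      unfolding sum.distrib[symmetric] by (intro sum.cong) (auto simp: min_def max_def)
    ultimately show ?thesis using L_submodular[of q q'] q(2) q'(2) by linarith
  qed
  then have submod: "submodular_surplus ?M"
    unfolding submodular_surplus_def by - (intro allI, rule field_le_epsilon, blast)
  have M: "?M = (?N, snd ?M)" by (simp add: merge_def)
  have "submodular_surplus (?N, snd ?M)" using submod by (simp only: M[symmetric])
  then have "gross_substitutes (?N, snd ?M)"
    using fin by (intro gross_substitutes_if_submodular_surplus) auto
  then show ?thesis by (simp only: M[symmetric])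
qed

lemma merge_in_GSV:
  assumes "U \<in> GSV n" "V \<in> GSV n"
  shows "merge U V \<in> GSV n"
proof -
  obtain E1 u1 E2 u2 where UV: "U = (E1, u1)" "V = (E2, u2)" by (cases U, cases V)
  have "finite E1" "finite E2"
    using assms unfolding UV GSV_def by (auto intro: finite_subset)
  then show ?thesis
    using assms valuation_merge gross_substitutes_merge unfolding UV GSV_def by simp
qed

text \<open>Owning \<open>A\<close> amounts to pricing it at \<open>- 1\<close>: by monotonicity,
  adding \<open>A\<close> to a set then never hurts, so it suffices to compare sets that contain
  \<open>A\<close>.\<close>

lemma demand_endow:
  assumes "finite E" "valuation (E, u)" "A \<subseteq> E"
  defines "r \<equiv> \<lambda>p i. if i \<in> A then - 1 else p i :: real"
  shows "demand (endow A (E, u)) p = {S. S \<inter> A = {} \<and> S \<union> A \<in> demand (E, u) (r p)}"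
proof -
  have finA: "finite A" using assms finite_subset by blast
  have sum_r: "sum (r p) (S \<union> A) = sum p S - card A" if "S \<subseteq> E - A" for S
  proof -
    have "finite S" using that assms(1) finite_subset by blast
    moreover have "sum (r p) S = sum p S" using that by (intro sum.cong) (auto simp: r_def)
    moreover have "sum (r p) A = - card A" by (simp add: r_def)
    ultimately show ?thesis using that finA by (subst sum.union_disjoint) auto
  qed
  have ge: "u T - sum (r p) T \<le> u (T \<union> A) - sum (r p) (T \<union> A)" if "T \<subseteq> E" for T
  proof -
    have finT: "finite T" using that assms(1) finite_subset by blast
    have "sum (r p) (T \<union> (A - T)) = sum (r p) T + sum (r p) (A - T)"
      using finT finA by (intro sum.union_disjoint) auto
    moreover have "sum (r p) (A - T) \<le> 0" by (intro sum_nonpos) (auto simp: r_def)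
    moreover have "u T \<le> u (T \<union> A)" using assms that by (intro valuation_mono[of E]) auto
    ultimately show ?thesis by simp
  qed
  have "S \<in> demand (endow A (E, u)) p \<longleftrightarrow> S \<inter> A = {} \<and> S \<union> A \<in> demand (E, u) (r p)" for S
  proof -
    have "S \<in> demand (endow A (E, u)) p \<longleftrightarrow> S \<subseteq> E - A \<and>
        (\<forall>T. T \<subseteq> E - A \<longrightarrow> u (T \<union> A) - sum (r p) (T \<union> A) \<le> u (S \<union> A) - sum (r p) (S \<union> A))"
      by (auto simp: endow_def in_demand_iff sum_r)
    also have "\<dots> \<longleftrightarrow> S \<inter> A = {} \<and> S \<union> A \<in> demand (E, u) (r p)"
    proof (intro iffI conjI)
      assume S: "S \<subseteq> E - A \<and>
        (\<forall>T. T \<subseteq> E - A \<longrightarrow> u (T \<union> A) - sum (r p) (T \<union> A) \<le> u (S \<union> A) - sum (r p) (S \<union> A))"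
      then show "S \<inter> A = {}" by auto
      have "u T - sum (r p) T \<le> u (S \<union> A) - sum (r p) (S \<union> A)" if "T \<subseteq> E" for T
      proof -
        have "T - A \<subseteq> E - A" using that by blast
        with S have "u (T \<union> A) - sum (r p) (T \<union> A) \<le> u (S \<union> A) - sum (r p) (S \<union> A)"
          by (metis Un_Diff_cancel2)
        with ge[OF that] show ?thesis by simp
      qed
      then show "S \<union> A \<in> demand (E, u) (r p)"
        using S assms(3) by (auto simp: in_demand_iff)
    next
      assume S: "S \<inter> A = {} \<and> S \<union> A \<in> demand (E, u) (r p)"
      then show "S \<subseteq> E - A" by (auto simp: in_demand_iff)
      show "\<forall>T. T \<subseteq> E - A \<longrightarrow> u (T \<union> A) - sum (r p) (T \<union> A) \<le> u (S \<union> A) - sum (r p) (S \<union> A)"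
        using S assms(3) unfolding in_demand_iff by blast
    qed
    finally show ?thesis .
  qed
  then show ?thesis by blast
qed

lemma endow_in_GSV:
  assumes U: "U \<in> GSV n" and A: "A \<subseteq> fst U"
  shows "endow A U \<in> GSV n"
proof -
  obtain E u where Eu: "U = (E, u)" by (cases U)
  have E: "E \<subseteq> {1..n}" and val: "valuation (E, u)" and gs: "gross_substitutes (E, u)"
    and AE: "A \<subseteq> E" using U A by (auto simp: Eu GSV_def)
  have fin: "finite E" using E finite_subset by blast
  define u' where "u' = (\<lambda>S \<in> Pow (E - A). u (S \<union> A) - u A)"
  have endow: "endow A (E, u) = (E - A, u')" by (simp add: endow_def u'_def)
  have "u A \<le> u (S \<union> A)" if "S \<subseteq> E - A" for S
    using that AE by (intro valuation_mono[OF val]) auto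
  moreover have "u (S \<union> A) \<le> u (T \<union> A)" if "S \<subseteq> T" "T \<subseteq> E - A" for S T
    using that AE by (intro valuation_mono[OF val]) auto
  ultimately have "valuation (E - A, u')"
    by (auto simp: valuation_def u'_def)
  moreover have "gross_substitutes (E - A, u')"
  proof (rule gross_substitutesI)
    fix p q :: "nat \<Rightarrow> real" and S
    assume le: "\<And>i. i \<in> E - A \<Longrightarrow> p i \<le> q i" and S: "S \<in> demand (E - A, u') p"
    let ?r = "\<lambda>p i. if i \<in> A then - 1 else p i :: real"
    note demand = demand_endow[OF fin val AE, unfolded endow]
    have SA: "S \<inter> A = {}" "S \<union> A \<in> demand (E, u) (?r p)" using S by (auto simp: demand)
    have "?r p i \<le> ?r q i" if "i \<in> E" for i using le that by simp
    then obtain T where T: "T \<in> demand (E, u) (?r q)" "{i \<in> S \<union> A. ?r p i = ?r q i} \<subseteq> T"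
      by (rule gross_substitutesE[OF gs _ SA(2)])
    \<comment> \<open>The items of \<open>A\<close> cost \<open>- 1\<close> under both price
      vectors, so substitutability itself retains them.\<close>
    then have "A \<subseteq> T" by auto
    then have "(T - A) \<union> A = T" by blast
    then have "T - A \<in> demand (E - A, u') q" using T by (simp add: demand Diff_disjoint[of A] Int_commute)
    moreover have "{i \<in> S. p i = q i} \<subseteq> T - A" using T SA by auto
    ultimately show "\<exists>T \<in> demand (E - A, u') q. {i \<in> S. p i = q i} \<subseteq> T" by blast
  qed
  ultimately show ?thesis using E by (auto simp: Eu endow GSV_def)
qed

lemma weighted_ranks_subset_GSV: "weighted_ranks n \<subseteq> GSV n"
  unfolding weighted_ranks_def by (auto simp del: One_nat_def intro!: weighted_rank_in_GSV)

lemma merge_closed_GSV: "merge_closed (GSV n)"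
  unfolding merge_closed_def using merge_in_GSV by blast

lemma endow_closed_GSV: "endow_closed (GSV n)"
  unfolding endow_closed_def using endow_in_GSV by blast

lemma MBV_subset_GSV: "MBV n \<subseteq> GSV n"
  unfolding MBV_def using weighted_ranks_subset_GSV merge_closed_GSV endow_closed_GSV
  by (intro Inter_lower) blast

section \<open>Four or more items\<close>

text \<open>At the prices \<open>r S\<close> the surplus is \<open>u S + card S\<close>. Minimum and
  maximum of \<open>r A\<close> and \<open>r B\<close> are the prices for
  \<open>A \<union> B\<close> and \<open>A \<inter> B\<close>, and the cardinalities cancel.\<close>

lemma gross_substitutes_submodular:
  assumes fin: "finite E" and val: "valuation (E, u)" and gs: "gross_substitutes (E, u)"
    and AB: "A \<subseteq> E" "B \<subseteq> E"
  shows "u (A \<union> B) + u (A \<inter> B) \<le> u A + u B"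
proof -
  \<comment> \<open>prices at which exactly the items of \<open>S\<close> are worth buying\<close>
  define r where "r S = (\<lambda>i. if i \<in> S then - 1 else u E :: real)" for S :: "nat set"
  have S: "surplus (E, u) (r S) = u S + card S" if "S \<subseteq> E" for S
  proof -
    have finS: "finite S" using that fin finite_subset by blast
    have sum_r: "sum (r S) T = u E * card (T - S) - card (T \<inter> S)" if "T \<subseteq> E" for T
    proof -
      have "finite T" using that fin finite_subset by blast
      then have "sum (r S) T = sum (r S) (T - S) + sum (r S) (T \<inter> S)"
        using sum.Int_Diff[of T "r S" S] by simp
      also have "sum (r S) (T - S) = u E * card (T - S)" by (simp add: r_def)
      also have "sum (r S) (T \<inter> S) = - card (T \<inter> S)" by (simp add: r_def)
      finally show ?thesis by simp
    qed
    have "S \<in> demand (E, u) (r S)"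
      unfolding in_demand_iff
    proof (intro conjI allI impI)
      fix T assume T: "T \<subseteq> E"
      have finT: "finite T" using T fin finite_subset by blast
      have card: "card (T \<inter> S) \<le> card S" using finS by (intro card_mono) auto
      have "u T - u E * card (T - S) \<le> u S"
      proof (cases "T \<subseteq> S")
        case True
        then have "card (T - S) = 0" by (metis Diff_eq_empty_iff card.empty)
        then show ?thesis using valuation_mono[OF val True that] by simp
      next
        case False
        then have "card (T - S) \<ge> 1" using finT by (simp add: Suc_le_eq card_gt_0_iff)
        then have "u E * 1 \<le> u E * card (T - S)"
          using valuation_nonneg[OF val, of E] by (intro mult_left_mono) auto
        moreover have "u T \<le> u E" "0 \<le> u S"
          using valuation_mono[OF val T] valuation_nonneg[OF val that] by auto
        ultimately show ?thesis by simp
      qed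
      then show "u T - sum (r S) T \<le> u S - sum (r S) S"
        using card sum_r[OF T] sum_r[OF that] by simp
    qed (rule that)
    from surplus_eq[OF fin this] show ?thesis using sum_r[OF that] by simp
  qed
  have finAB: "finite A" "finite B" using AB fin finite_subset by blast+
  have "0 \<le> u E" using val by (rule valuation_nonneg) simp
  then have "(\<lambda>i. min (r A i) (r B i)) = r (A \<union> B)" "(\<lambda>i. max (r A i) (r B i)) = r (A \<inter> B)"
    by (auto simp: r_def fun_eq_iff)
  then have "surplus (E, u) (r (A \<union> B)) + surplus (E, u) (r (A \<inter> B))
      \<le> surplus (E, u) (r A) + surplus (E, u) (r B)"
    using submodular_surplus_if_gross_substitutes[OF fin gs] unfolding submodular_surplus_def by metis
  moreover have "A \<union> B \<subseteq> E" "A \<inter> B \<subseteq> E" using AB by auto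
  ultimately show ?thesis
    using S AB card_Un_Int[OF finAB] by simp
qed

text \<open>For disjoint \<open>A\<close>, \<open>B\<close> and
  \<open>S \<subseteq> A \<union> B\<close> this is a sum of two matroid ranks: the uniform matroid
  of rank one plus the partition matroid that allows one item from each class.\<close>

definition two_class_fun :: "nat set \<Rightarrow> nat set \<Rightarrow> nat set \<Rightarrow> real" where
  "two_class_fun A B S = (if S = {} then 0 else if S \<subseteq> A \<or> S \<subseteq> B then 2 else 3)"

lemma two_class_fun_commute: "two_class_fun A B = two_class_fun B A"
  by (auto simp: two_class_fun_def fun_eq_iff)

lemma two_class_fun_mono: "S \<subseteq> T \<Longrightarrow> two_class_fun A B S \<le> two_class_fun A B T"
  by (auto simp: two_class_fun_def)

text \<open>Removing \<open>i\<close> costs something only if it is the last item of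
  \<open>A\<close> in \<open>X\<close>. An item of \<open>A\<close> in \<open>Y\<close> can then be
  swapped for it. If \<open>Y\<close> has none, the gain of \<open>Y\<close> pays for the loss,
  except when \<open>X = {i}\<close> and \<open>Y\<close> is nonempty, where any \<open>j\<close> of
  \<open>Y\<close> is returned. The case \<open>i \<in> B\<close> follows by
  \<open>two_class_fun_commute\<close>.\<close>

lemma two_class_fun_exchange:
  assumes disj: "A \<inter> B = {}" and XY: "X \<subseteq> A \<union> B" "Y \<subseteq> A \<union> B" and i: "i \<in> X - Y" "i \<in> A"
  defines "g \<equiv> two_class_fun A B"
  shows "g X + g Y \<le> g (X - {i}) + g (insert i Y) \<or>
    (\<exists>j \<in> Y - X. g X + g Y \<le> g (insert j (X - {i})) + g (insert i Y - {j}))"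
proof (cases "X \<inter> A = {i}")
  case False
  then obtain i' where "i' \<in> X \<inter> A" "i' \<noteq> i" using i by blast
  then have "g (X - {i}) = g X"
    using disj i by (auto simp: g_def two_class_fun_def)
  moreover have "g Y \<le> g (insert i Y)"
    unfolding g_def by (rule two_class_fun_mono) auto
  ultimately show ?thesis by simp
next
  case XA: True
  show ?thesis
  proof (cases "Y \<inter> A = {}")
    case False
    then obtain j where j: "j \<in> Y" "j \<in> A" by blast
    have "g (insert j (X - {i})) = g X"
      using disj i j XA by (auto simp: g_def two_class_fun_def)
    moreover have "g (insert i Y - {j}) = g Y"
      using disj i j by (auto simp: g_def two_class_fun_def)
    moreover have "j \<in> Y - X" using j XA i by auto
    ultimately show ?thesis by (metis order_refl)
  next
    case YA: True
    then have YB: "Y \<subseteq> B" using XY by blast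
    consider "X = {i}" "Y = {}" | j where "X = {i}" "j \<in> Y" | "X \<noteq> {i}" by blast
    then show ?thesis
    proof cases
      case 1
      then show ?thesis by (simp add: g_def two_class_fun_def)
    next
      case 2
      have "g X + g Y = 4" "g (insert j (X - {i})) = 2" "2 \<le> g (insert i Y - {j})"
        using 2 i YB by (auto simp: g_def two_class_fun_def)
      moreover have "j \<in> Y - X" using 2 i by blast
      ultimately show ?thesis by force
    next
      case 3
      have "X - {i} \<subseteq> B" "X - {i} \<noteq> {}" using 3 XA XY i by blast+
      moreover have "\<not> X \<subseteq> B" "\<not> X \<subseteq> A" using i disj 3 XA by blast+
      ultimately have "g X = 3" "g (X - {i}) = 2"
        using i by (auto simp: g_def two_class_fun_def)
      moreover have "g Y + 1 \<le> g (insert i Y)"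
        using YB YA i disj by (auto simp: g_def two_class_fun_def)
      ultimately show ?thesis by simp
    qed
  qed
qed

definition two_class :: "nat \<Rightarrow> setfun" where
  "two_class n = ({1..n}, restrict (two_class_fun {1, 2} {3..n}) (Pow {1..n}))"

lemma two_class_in_GSV:
  assumes "n \<ge> 2"
  shows "two_class n \<in> GSV n"
proof -
  let ?g = "two_class_fun {1, 2} {3..n}"
  let ?u = "restrict ?g (Pow {1..n})"
  have un: "{1..n} = {1, 2} \<union> {3..n}" using assms by auto
  have "valuation ({1..n}, ?u)"
    using two_class_fun_mono[of _ _ "{1, 2}" "{3..n}"]
    by (auto simp: valuation_def two_class_fun_def)
  moreover have "exchange_property ({1..n}, ?u)"
  proof -
    have "?g X + ?g Y \<le> ?g (X - {i}) + ?g (insert i Y) \<or>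
      (\<exists>j \<in> Y - X. ?g X + ?g Y \<le> ?g (insert j (X - {i})) + ?g (insert i Y - {j}))"
      if "X \<subseteq> {1..n}" "Y \<subseteq> {1..n}" "i \<in> X - Y" for X Y i
    proof (cases "i \<in> {1, 2}")
      case True
      then show ?thesis
        using that unfolding un by (intro two_class_fun_exchange) auto
    next
      case False
      then have "i \<in> {3..n}" using that un by blast
      then show ?thesis
        using that unfolding un two_class_fun_commute[of "{1, 2}"] by (intro two_class_fun_exchange) auto
    qed
    moreover have "insert i Y \<subseteq> {1..n}" "X - {i} \<subseteq> {1..n}" "insert j (X - {i}) \<subseteq> {1..n}" "insert i Y - {j} \<subseteq> {1..n}"
      if "X \<subseteq> {1..n}" "Y \<subseteq> {1..n}" "i \<in> X - Y" "j \<in> Y - X" for X Y i j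
      using that by blast+
    moreover have "insert i Y \<subseteq> {1..n}" "X - {i} \<subseteq> {1..n}"
      if "X \<subseteq> {1..n}" "Y \<subseteq> {1..n}" "i \<in> X - Y" for X Y i
      using that by blast+
    ultimately show ?thesis
      unfolding exchange_property_def by (simp del: insert_subset) blast
  qed
  ultimately show ?thesis
    by (auto simp: GSV_def two_class_def intro: gross_substitutes_if_exchange_property)
qed

text \<open>The singletons force the weights of \<open>1\<close> and \<open>3\<close> to be
  \<open>2\<close>, so \<open>{1, 3}\<close> would get a multiple of \<open>2\<close> instead of
  \<open>3\<close>.\<close>

lemma two_class_not_weighted_rank:
  assumes "n \<ge> 3"
  shows "two_class n \<notin> weighted_ranks n"
proof
  assume "two_class n \<in> weighted_ranks n"
  then obtain E \<I> w where U: "two_class n = weighted_rank E \<I> w" and M: "matroid E \<I>"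
    unfolding weighted_ranks_def by blast
  have E: "E = {1..n}" using U by (simp add: two_class_def weighted_rank_def)
  have val: "snd (weighted_rank E \<I> w) S = two_class_fun {1, 2} {3..n} S" if "S \<subseteq> {1..n}" for S
    using that unfolding U[symmetric] two_class_def by simp
  have w: "w i = 2" if "i \<in> {1, 3}" for i
  proof -
    have i: "{i} \<subseteq> E" using that assms E by auto
    obtain I where "I \<subseteq> {i}" "snd (weighted_rank E \<I> w) {i} = sum w I"
      by (rule weighted_rank_attained[OF M i, of w])
    moreover have "snd (weighted_rank E \<I> w) {i} = 2"
      using that assms i E by (subst val) (auto simp: two_class_fun_def)
    ultimately show ?thesis by (auto simp: subset_singleton_iff)
  qed
  have i: "{1, 3} \<subseteq> E" using assms E by auto
  obtain I where I: "I \<subseteq> {1, 3}" "snd (weighted_rank E \<I> w) {1, 3} = sum w I"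
    by (rule weighted_rank_attained[OF M i, of w])
  have "snd (weighted_rank E \<I> w) {1, 3} = 3"
    using assms i E by (subst val) (auto simp: two_class_fun_def)
  moreover have "sum w I = 2 * card I"
    using w I by (subst sum.cong[of I I w "\<lambda>_. 2"]) auto
  ultimately have "real 3 = real (2 * card I)" using I by simp
  then have "3 = 2 * card I" by (simp only: of_nat_eq_iff)
  then show False by presburger
qed

text \<open>The bound \<open>u1 S \<le> ?g S\<close> comes from giving everything to
  \<open>u1\<close>. For the converse, monotonicity reduces the claim to singletons and to pairs
  that meet both classes.\<close>

lemma merge_eq_two_class_left:
  assumes n: "n \<ge> 4" and U1: "(E1, u1) \<in> GSV n" and U2: "(E2, u2) \<in> GSV n"
    and merge: "merge (E1, u1) (E2, u2) = two_class n"
    and u1: "\<And>i. i \<in> {1..n} \<Longrightarrow> i \<in> E1 \<and> u1 {i} = 2"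
  shows "(E1, u1) = two_class n"
proof -
  let ?g = "two_class_fun {1, 2} {3..n}"
  have E: "E1 = {1..n}" "E2 \<subseteq> {1..n}" and val: "valuation (E1, u1)" "valuation (E2, u2)"
    and gs: "gross_substitutes (E2, u2)"
    using U1 U2 u1 by (auto simp: GSV_def)
  have fin: "finite E1" "finite E2" using E finite_subset by auto
  have mval: "snd (merge (E1, u1) (E2, u2)) S = ?g S" if "S \<subseteq> {1..n}" for S
    using that unfolding merge two_class_def by simp
  have le: "u1 T + u2 R \<le> ?g (T \<union> R)" if "T \<subseteq> E1" "R \<subseteq> E2" "T \<inter> R = {}" for T R
    using merge_ge[OF fin that, of u1 u2] mval[of "T \<union> R"] that E by simp
  have zero: "u2 {i} = 0" if "i \<in> E2" for i
  proof -
    \<comment> \<open>a second item in the class of \<open>i\<close>\<close>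
    define k where "k = (if i = 1 then 2 else if i = 2 then 1 else if i = 3 then 4 else (3::nat))"
    have i: "i \<in> {1..n}" using that E by blast
    then have k: "k \<in> {1..n}" "k \<noteq> i" "{k, i} \<subseteq> {1, 2} \<or> {k, i} \<subseteq> {3..n}"
      using n by (auto simp: k_def)
    have "u1 {k} + u2 {i} \<le> ?g ({k} \<union> {i})"
      using k that E by (intro le) auto
    also have "\<dots> = 2" using k(3) by (auto simp: two_class_fun_def)
    finally have "u2 {i} \<le> 0" using u1[OF k(1)] by simp
    moreover have "0 \<le> u2 {i}" using that by (intro valuation_nonneg[OF val(2)]) auto
    ultimately show ?thesis by simp
  qed
  \<comment> \<open>As \<open>u2\<close> vanishes on singletons and, by submodularity, on this pair,
    every split other than giving both items to \<open>u1\<close> yields at most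
    \<open>2\<close>.\<close>
  have pair: "u1 {i, j} = 3" if i: "i \<in> {1, 2}" and j: "j \<in> {3..n}" for i j
  proof -
    have g: "?g {i, j} = 3" using i j by (auto simp: two_class_fun_def)
    have ijn: "i \<in> {1..n}" "j \<in> {1..n}" "i \<noteq> j" using i j n by auto
    then have ij: "{i, j} \<subseteq> E1 \<union> E2" using E by auto
    obtain T R where TR: "T \<subseteq> E1" "R \<subseteq> E2" "T \<inter> R = {}" "T \<union> R = {i, j}"
      "snd (merge (E1, u1) (E2, u2)) {i, j} = u1 T + u2 R"
      by (rule merge_attained[OF fin ij, of u1 u2])
    have sum3: "u1 T + u2 R = 3" using TR(5) mval[of "{i, j}"] ijn g by simp
    have "R = {i, j} - T" using TR(3,4) by blast
    moreover have "T \<in> Pow {i, j}" using TR(4) by blast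
    then have "T = {} \<or> T = {i} \<or> T = {j} \<or> T = {i, j}" by (auto simp: Pow_insert)
    ultimately consider "T = {i, j}" "R = {}" | "T = {i}" "R = {j}" | "T = {j}" "R = {i}"
      | "T = {}" "R = {i, j}"
      using ijn(3) by fastforce
    then show ?thesis
    proof cases
      case 1
      then show ?thesis using sum3 valuation_empty[OF val(2)] by simp
    next
      case 2
      then show ?thesis using sum3 zero[of j] TR u1[of i] ijn by simp
    next
      case 3
      then show ?thesis using sum3 zero[of i] TR u1[of j] ijn by simp
    next
      case 4
      then have "{i} \<subseteq> E2" "{j} \<subseteq> E2" using TR by auto
      from gross_substitutes_submodular[OF fin(2) val(2) gs this]
      have "u2 {i, j} \<le> 0"
        using zero 4 TR ijn valuation_empty[OF val(2)] by (simp add: insert_commute)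
      then show ?thesis using sum3 4 valuation_empty[OF val(1)] by simp
    qed
  qed
  have "u1 S = ?g S" if S: "S \<subseteq> {1..n}" for S
  proof (rule antisym)
    show "u1 S \<le> ?g S"
      using le[of S "{}"] S E valuation_empty[OF val(2)] by simp
    consider "S = {}" | i where "i \<in> S" "S \<subseteq> {1, 2} \<or> S \<subseteq> {3..n}"
      | i j where "i \<in> S" "j \<in> S" "i \<notin> {3..n}" "j \<notin> {1, 2}" "\<not> (S \<subseteq> {1, 2} \<or> S \<subseteq> {3..n})"
      by blast
    then show "?g S \<le> u1 S"
    proof cases
      case 1
      then show ?thesis using valuation_empty[OF val(1)] by (simp add: two_class_fun_def)
    next
      case (2 i)
      then have "?g S = u1 {i}" using u1[of i] S by (auto simp: two_class_fun_def)
      then show ?thesis using valuation_mono[OF val(1), of "{i}" S] 2 S E by simp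
    next
      case (3 i j)
      then have "i \<in> {1, 2}" "j \<in> {3..n}" using S by force+
      then have "u1 {i, j} = 3" by (rule pair)
      moreover have "?g S = 3" using 3 by (auto simp: two_class_fun_def)
      ultimately show ?thesis using valuation_mono[OF val(1), of "{i, j}" S] 3 S E by simp
    qed
  qed
  moreover have "u1 \<in> extensional (Pow {1..n})" using val(1) E by (simp add: valuation_def)
  ultimately have "u1 = restrict ?g (Pow {1..n})"
    by (intro extensionalityI[of _ "Pow {1..n}"]) auto
  then show ?thesis using E by (simp add: two_class_def)
qed

lemma merge_commute:
  assumes "finite (fst U)" "finite (fst V)"
  shows "merge U V = merge V U"
proof -
  obtain E1 u1 E2 u2 where UV: "U = (E1, u1)" "V = (E2, u2)" by (cases U, cases V)
  have fin: "finite E1" "finite E2" using assms UV by auto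
  have le: "snd (merge (F1, v1) (F2, v2)) S \<le> snd (merge (F2, v2) (F1, v1)) S"
    if F: "finite F1" "finite F2" "S \<subseteq> F1 \<union> F2" for F1 v1 F2 v2 S
  proof -
    obtain T R where TR: "T \<subseteq> F1" "R \<subseteq> F2" "T \<inter> R = {}" "T \<union> R = S"
      "snd (merge (F1, v1) (F2, v2)) S = v1 T + v2 R"
      by (rule merge_attained[OF F, of v1 v2])
    then show ?thesis
      using merge_ge[OF F(2,1), of R T v2 v1] by (simp add: Un_commute Int_commute)
  qed
  have "snd (merge U V) S = snd (merge V U) S" for S
  proof (cases "S \<subseteq> E1 \<union> E2")
    case True
    then show ?thesis
      unfolding UV using fin by (intro antisym le) auto
  next
    case False
    then show ?thesis by (auto simp: UV merge_def)
  qed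
  then have "snd (merge U V) = snd (merge V U)" by (rule ext)
  then show ?thesis by (intro prod_eqI) auto
qed

text \<open>One of the two valuations must give each singleton its value \<open>2\<close>. If
  different valuations did so for two distinct items, that pair would be worth at least
  \<open>4\<close>, so a single valuation does it for all items.\<close>

lemma merge_eq_two_class:
  assumes n: "n \<ge> 4" and UV: "U \<in> GSV n" "V \<in> GSV n" and merge: "merge U V = two_class n"
  shows "U = two_class n \<or> V = two_class n"
proof -
  obtain E1 u1 E2 u2 where eqs: "U = (E1, u1)" "V = (E2, u2)" by (cases U, cases V)
  have E: "E1 \<union> E2 = {1..n}" using merge unfolding eqs by (simp add: merge_def two_class_def)
  then have fin: "finite E1" "finite E2" by (metis finite_Un finite_atLeastAtMost)+
  have zero: "u1 {} = 0" "u2 {} = 0" using UV valuation_empty by (auto simp: eqs GSV_def)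
  let ?g = "two_class_fun {1, 2} {3..n}"
  have mval: "snd (merge (E1, u1) (E2, u2)) S = ?g S" if "S \<subseteq> {1..n}" for S
    using that merge unfolding eqs two_class_def by simp
  define P where "P F v i \<longleftrightarrow> i \<in> F \<and> v {i} = (2::real)" for F and v :: "nat set \<Rightarrow> real" and i :: nat
  have either: "P E1 u1 i \<or> P E2 u2 i" if i: "i \<in> {1..n}" for i
  proof -
    have ij: "{i} \<subseteq> E1 \<union> E2" using i E by simp
    obtain T R where TR: "T \<subseteq> E1" "R \<subseteq> E2" "T \<inter> R = {}" "T \<union> R = {i}"
      "snd (merge (E1, u1) (E2, u2)) {i} = u1 T + u2 R"
      by (rule merge_attained[OF fin ij, of u1 u2])
    have "?g {i} = 2" using i by (auto simp: two_class_fun_def)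
    then have sum2: "u1 T + u2 R = 2" using TR(5) mval[of "{i}"] i by simp
    consider "T = {i}" "R = {}" | "T = {}" "R = {i}" 
      using TR(3,4) by (auto simp: Un_singleton_iff)
    then show ?thesis using sum2 zero TR by cases (auto simp: P_def)
  qed
  have notboth: "\<not> (P E1 u1 i \<and> P E2 u2 j)" if "i \<noteq> j" for i j
  proof
    assume "P E1 u1 i \<and> P E2 u2 j"
    then have "4 \<le> snd (merge (E1, u1) (E2, u2)) ({i} \<union> {j})" and "{i} \<union> {j} \<subseteq> {1..n}"
      using merge_ge[OF fin, of "{i}" "{j}" u1 u2] that E by (auto simp: P_def)
    then have "4 \<le> ?g ({i} \<union> {j})" using mval by metis
    then show False by (auto simp: two_class_fun_def split: if_splits)
  qed
  have "(\<forall>i \<in> {1..n}. P E1 u1 i) \<or> (\<forall>i \<in> {1..n}. P E2 u2 i)"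
    using either notboth by metis
  then show ?thesis
  proof
    assume "\<forall>i \<in> {1..n}. P E1 u1 i"
    then have "(E1, u1) = two_class n"
      using n UV merge unfolding eqs P_def by (intro merge_eq_two_class_left) auto
    then show ?thesis by (simp add: eqs)
  next
    assume "\<forall>i \<in> {1..n}. P E2 u2 i"
    moreover have "merge (E2, u2) (E1, u1) = two_class n"
      using merge merge_commute[of U V] fin unfolding eqs by simp
    ultimately have "(E2, u2) = two_class n"
      using n UV unfolding eqs P_def by (intro merge_eq_two_class_left) auto
    then show ?thesis by (simp add: eqs)
  qed
qed

lemma MBV_psubset_GSV:
  assumes n: "n \<ge> 4"
  shows "MBV n \<subset> GSV n"
proof -
  let ?A = "GSV n - {two_class n}"
  have "weighted_ranks n \<subseteq> ?A"
    using weighted_ranks_subset_GSV two_class_not_weighted_rank[of n] n by auto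
  moreover have "merge_closed ?A"
    using merge_in_GSV merge_eq_two_class[OF n] unfolding merge_closed_def by blast
  moreover have "endow_closed ?A"
    unfolding endow_closed_def
  proof (intro ballI allI impI)
    fix U T assume U: "U \<in> ?A" and T: "T \<subseteq> fst U"
    obtain E u where Eu: "U = (E, u)" by (cases U)
    \<comment> \<open>The result has the full ground set only if \<open>T\<close> is empty, and then
      endowment changes nothing.\<close>
    have "endow T U \<noteq> two_class n"
    proof
      assume eq: "endow T U = two_class n"
      then have "E - T = {1..n}" by (simp add: Eu endow_def two_class_def)
      moreover have "E \<subseteq> {1..n}" "u \<in> extensional (Pow E)" "u {} = 0"
        using U by (auto simp: Eu GSV_def valuation_def)
      ultimately have "T = {}" using T Eu by auto
      then have "endow T U = U"
        using \<open>u \<in> extensional (Pow E)\<close> \<open>u {} = 0\<close>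
        by (auto simp: Eu endow_def extensional_restrict)
      then show False using eq U by simp
    qed
    then show "endow T U \<in> ?A" using endow_in_GSV U T by blast
  qed
  ultimately have "MBV n \<subseteq> ?A"
    unfolding MBV_def by (intro Inter_lower) blast
  then show ?thesis using two_class_in_GSV[of n] n by auto
qed

section \<open>At most three items\<close>

text \<open>Choose the sum \<open>s\<close> first and then split it. This supplies two prices in
  \<open>triple_exchange\<close> that are bounded individually and in sum.\<close>

lemma interval_pair_with_sum:
  fixes l1 h1 l2 h2 s1 s2 :: real
  assumes "l1 < h1" "l2 < h2" "l1 + l2 < s2" "s1 < h1 + h2" "s1 < s2"
  obtains x y where "l1 < x" "x < h1" "l2 < y" "y < h2" "s1 < x + y" "x + y < s2"
proof -
  have "max (l1 + l2) s1 < min (h1 + h2) s2" using assms by simp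
  then obtain s where "max (l1 + l2) s1 < s" "s < min (h1 + h2) s2" using dense by blast
  then have s: "l1 + l2 < s" "s < h1 + h2" "s1 < s" "s < s2" by auto
  have "max l1 (s - h2) < min h1 (s - l2)" using s assms by simp
  then obtain x where "max l1 (s - h2) < x" "x < min h1 (s - l2)" using dense by blast
  then show thesis using s by (intro that[of x "s - x"]) auto
qed

text \<open>Otherwise some prices make \<open>{x, y}\<close> and \<open>{z}\<close> the only
  demanded bundles. Raising the price of \<open>x\<close> leaves \<open>{z}\<close> strictly better
  than every set with \<open>y\<close>, although substitutability has to keep \<open>y\<close>. Over
  all permutations, the lemma says that the largest of the three sums is attained at least
  twice.\<close>

lemma triple_exchange:
  assumes dist: "x \<noteq> y" "x \<noteq> z" "y \<noteq> z"
    and val: "valuation ({x, y, z}, u)" and gs: "gross_substitutes ({x, y, z}, u)"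
  shows "u {x, y} + u {z} \<le> max (u {x, z} + u {y}) (u {y, z} + u {x})"
proof (rule ccontr)
  let ?E = "{x, y, z}"
  assume "\<not> ?thesis"
  then have gt: "u {x, z} + u {y} < u {x, y} + u {z}" "u {y, z} + u {x} < u {x, y} + u {z}" by auto
  have submod: "u (A \<union> B) + u (A \<inter> B) \<le> u A + u B" if "A \<subseteq> ?E" "B \<subseteq> ?E" for A B
    using that by (intro gross_substitutes_submodular[OF _ val gs]) auto
  have zero: "u {} = 0" using val by (rule valuation_empty)
  have sets: "{x, y} \<union> {x, z} = ?E" "{x, y} \<inter> {x, z} = {x}"
    "{x, y} \<union> {y, z} = ?E" "{x, y} \<inter> {y, z} = {y}" "{x} \<union> {y} = {x, y}" "{x} \<inter> {y} = {}"
    "{y} \<union> {z} = {y, z}" "{y} \<inter> {z} = {}"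
    using dist by auto
  have sub: "u ?E + u {x} \<le> u {x, y} + u {x, z}" "u ?E + u {y} \<le> u {x, y} + u {y, z}"
    "u {x, y} \<le> u {x} + u {y}" "u {y, z} \<le> u {y} + u {z}"
    using submod[of "{x, y}" "{x, z}"] submod[of "{x, y}" "{y, z}"] submod[of "{x}" "{y}"]
      submod[of "{y}" "{z}"] zero
    unfolding sets by auto
  \<comment> \<open>prices at which precisely the two bundles \<open>{x, y}\<close> and \<open>{z}\<close> are demanded\<close>
  obtain p1 p2 where p12: "u {x, z} - u {z} < p1" "p1 < u {x, y} - u {y}"
    "u {y, z} - u {z} < p2" "p2 < u {x, y} - u {x}" "u ?E - u {z} < p1 + p2" "p1 + p2 < u {x, y}"
    by (rule interval_pair_with_sum[of "u {x, z} - u {z}" "u {x, y} - u {y}" "u {y, z} - u {z}"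
          "u {x, y} - u {x}" "u {x, y}" "u ?E - u {z}"]) (use gt sub in linarith)+
  \<comment> \<open>This value makes \<open>{x, y}\<close> and \<open>{z}\<close> tie. The
    inequalities in \<open>p12\<close> then say, in order, that \<open>{x, z}\<close>,
    \<open>{y}\<close>, \<open>{y, z}\<close>, \<open>{x}\<close>, \<open>?E\<close> and
    \<open>{}\<close> are strictly worse.\<close>
  define p3 where "p3 = u {z} - u {x, y} + p1 + p2"
  define p where "p = (\<lambda>i. if i = x then p1 else if i = y then p2 else p3)"
  define q where "q = p(x := p1 + 1)"
  have px: "p x = p1" "p y = p2" "p z = p3" "q x = p1 + 1" "q y = p2" "q z = p3"
    using dist by (auto simp: p_def q_def)
  have Pow: "T \<in> {{}, {x}, {y}, {z}, {x, y}, {x, z}, {y, z}, ?E}" if "T \<subseteq> ?E" for T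
  proof -
    have "T \<in> Pow ?E" using that by simp
    then show ?thesis by (auto simp: Pow_insert)
  qed
  have "u T - sum p T \<le> u {x, y} - sum p {x, y}" if "T \<subseteq> ?E" for T
    using Pow[OF that] p12 zero dist by (auto simp: px p3_def)
  then have "{x, y} \<in> demand (?E, u) p" by (auto simp: in_demand_iff)
  moreover have "p i \<le> q i" for i by (simp add: q_def p_def)
  ultimately obtain T where T: "T \<in> demand (?E, u) q" and "{i \<in> {x, y}. p i = q i} \<subseteq> T"
    using gross_substitutesE[OF gs, of p q "{x, y}"] by blast
  then have "y \<in> T" using dist by (auto simp: q_def)
  have TE: "T \<subseteq> ?E" and zT: "u {z} - sum q {z} \<le> u T - sum q T"
    using T unfolding in_demand_iff by blast+
  have "T = {y} \<or> T = {x, y} \<or> T = {y, z} \<or> T = ?E"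
    using Pow[OF TE] \<open>y \<in> T\<close> dist by auto
  then show False
    using zT p12 dist by (elim disjE) (simp_all add: px p3_def)
qed

section \<open>Merging with weighted ranks of rank one\<close>

definition rank_one :: "nat set \<Rightarrow> (nat \<Rightarrow> real) \<Rightarrow> setfun" where
  "rank_one E w = weighted_rank E (insert {} ((\<lambda>i. {i}) ` E)) w"

lemma matroid_rank_one: "finite E \<Longrightarrow> matroid E (insert {} ((\<lambda>i. {i}) ` E))"
  unfolding matroid_def by (auto simp: subset_singleton_iff)

lemma rank_one_in_weighted_ranks:
  assumes "E \<subseteq> {1..n}" "\<And>i. i \<in> E \<Longrightarrow> 0 \<le> w i"
  shows "rank_one E w \<in> weighted_ranks n"
proof -
  have "finite E" using assms(1) finite_subset by blast
  then show ?thesis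
    using matroid_rank_one[of E] assms unfolding rank_one_def weighted_ranks_def by blast
qed

lemma rank_one_zero: "rank_one E (\<lambda>_. 0) = (E, \<lambda>S \<in> Pow E. 0)"
proof -
  have "{sum (\<lambda>_. 0 :: real) I | I. I \<in> insert {} ((\<lambda>i. {i}) ` E) \<and> I \<subseteq> T} = {0}" for T by auto
  then show ?thesis by (simp add: rank_one_def weighted_rank_def)
qed

text \<open>A weighted rank of rank one uses at most one item of its share, so only splits with at
  most one item on its side matter. The hypotheses describe \<open>v S\<close> as the maximum over
  these.\<close>

lemma merge_rank_one:
  assumes fin: "finite E" and val: "valuation (E, u)" and v: "v \<in> extensional (Pow E)"
    and ge: "\<And>S. S \<subseteq> E \<Longrightarrow> u S \<le> v S"
    and ge': "\<And>S i. S \<subseteq> E \<Longrightarrow> i \<in> S \<Longrightarrow> u (S - {i}) + w i \<le> v S"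
    and att: "\<And>S. S \<subseteq> E \<Longrightarrow> v S = u S \<or> (\<exists>i \<in> S. v S = u (S - {i}) + w i)"
  shows "merge (E, u) (rank_one E w) = (E, v)"
proof -
  let ?I = "insert {} ((\<lambda>i. {i}) ` E)"
  define r where "r = snd (rank_one E w)"
  have R: "rank_one E w = (E, r)" by (simp add: r_def rank_one_def weighted_rank_def)
  note M = matroid_rank_one[OF fin]
  have r_ge: "sum w I \<le> r T" if "I \<in> ?I" "I \<subseteq> T" "T \<subseteq> E" for I T
    using weighted_rank_ge[OF M that] by (simp add: r_def rank_one_def)
  have "snd (merge (E, u) (E, r)) S = v S" if S: "S \<subseteq> E" for S
  proof (rule antisym)
    have SE: "S \<subseteq> E \<union> E" using S by simp
    obtain T R where TR: "T \<subseteq> E" "R \<subseteq> E" "T \<inter> R = {}" "T \<union> R = S"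
      "snd (merge (E, u) (E, r)) S = u T + r R"
      by (rule merge_attained[OF fin fin SE, of u r])
    obtain I where I: "I \<in> ?I" "I \<subseteq> R" "r R = sum w I"
      unfolding r_def rank_one_def by (rule weighted_rank_attained[OF M TR(2), of w])
    show "snd (merge (E, u) (E, r)) S \<le> v S"
    proof (cases "I = {}")
      case True
      then show ?thesis
        using I TR ge[OF S] valuation_mono[OF val, of T S] S by auto
    next
      case False
      then obtain i where i: "I = {i}" "i \<in> R" using I by auto
      then have "u T \<le> u (S - {i})" using TR S by (intro valuation_mono[OF val]) auto
      then show ?thesis using TR I i ge'[OF S, of i] by auto
    qed
    from att[OF S] show "v S \<le> snd (merge (E, u) (E, r)) S"
    proof (elim disjE bexE)
      assume "v S = u S"
      then show ?thesis using merge_ge[OF fin fin S, of "{}" u r] r_ge[of "{}" "{}"] by simp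
    next
      fix i assume i: "i \<in> S" "v S = u (S - {i}) + w i"
      then have "S - {i} \<union> {i} = S" "S - {i} \<subseteq> E" "{i} \<subseteq> E" "(S - {i}) \<inter> {i} = {}" using S by auto
      then have "u (S - {i}) + r {i} \<le> snd (merge (E, u) (E, r)) S" "w i \<le> r {i}"
        using merge_ge[OF fin fin, of "S - {i}" "{i}" u r] r_ge[of "{i}" "{i}"] by (metis, simp)
      then show ?thesis using i by simp
    qed
  qed
  moreover have "snd (merge (E, u) (E, r)) \<in> extensional (Pow E)" by (simp add: merge_def)
  ultimately have "snd (merge (E, u) (E, r)) = v"
    using v by (intro extensionalityI[of _ "Pow E"]) auto
  then show ?thesis unfolding R by (intro prod_eqI) auto
qed

text \<open>
  A function on the subsets of \<open>E \<subseteq> {x, y, z}\<close> is given by its values in terms of the membership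
  of \<open>x\<close>, \<open>y\<close> and \<open>z\<close>. That \<open>E\<close> may be smaller treats all ground sets with at most three items at once.
\<close>

definition fun3 :: "nat \<Rightarrow> nat \<Rightarrow> nat \<Rightarrow> nat set \<Rightarrow> (bool \<Rightarrow> bool \<Rightarrow> bool \<Rightarrow> real) \<Rightarrow> setfun" where
  "fun3 x y z E f = (E, \<lambda>S \<in> Pow E. f (x \<in> S) (y \<in> S) (z \<in> S))"

text \<open>In terms of membership bits the conditions of \<open>merge_rank_one\<close> become
  finitely many linear (in)equalities between reals, uniformly in \<open>E\<close>.\<close>

lemma fun3_merge_rank_one:
  fixes wx wy wz :: real
  assumes dist: "x \<noteq> y" "x \<noteq> z" "y \<noteq> z" and E: "E \<subseteq> {x, y, z}" "E \<subseteq> {1..n}"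
    and A: "A \<subseteq> GSV n" "weighted_ranks n \<subseteq> A" "merge_closed A"
    and f: "fun3 x y z E f \<in> A" and w: "0 \<le> wx" "0 \<le> wy" "0 \<le> wz"
    and ge: "\<And>a b c. f a b c \<le> g a b c"
    and gex: "\<And>b c. f False b c + wx \<le> g True b c"
    and gey: "\<And>a c. f a False c + wy \<le> g a True c"
    and gez: "\<And>a b. f a b False + wz \<le> g a b True"
    and att: "\<And>a b c. g a b c = f a b c \<or> a \<and> g a b c = f False b c + wx \<or>
      b \<and> g a b c = f a False c + wy \<or> c \<and> g a b c = f a b False + wz"
  shows "fun3 x y z E g \<in> A"
proof -
  define w where "w = (\<lambda>i. if i = x then wx else if i = y then wy else wz)"
  have wxyz: "w x = wx" "w y = wy" "w z = wz" using dist by (auto simp: w_def)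
  have fin: "finite E" using E finite_subset by blast
  have "rank_one E w \<in> weighted_ranks n"
    using E(2) \<open>0 \<le> wx\<close> \<open>0 \<le> wy\<close> \<open>0 \<le> wz\<close>
    by (intro rank_one_in_weighted_ranks) (auto simp: w_def)
  then have "merge (fun3 x y z E f) (rank_one E w) \<in> A"
    using A f unfolding merge_closed_def by blast
  moreover have "merge (fun3 x y z E f) (rank_one E w) = fun3 x y z E g"
    unfolding fun3_def
  proof (rule merge_rank_one[OF fin])
    show "valuation (E, \<lambda>S \<in> Pow E. f (x \<in> S) (y \<in> S) (z \<in> S))"
      using A f unfolding GSV_def fun3_def by blast
  next
    fix S i assume S: "S \<subseteq> E" "i \<in> S"
    then have "i = x \<or> i = y \<or> i = z" "S - {i} \<subseteq> E" using E by auto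
    then show "(\<lambda>S \<in> Pow E. f (x \<in> S) (y \<in> S) (z \<in> S)) (S - {i}) + w i
        \<le> (\<lambda>S \<in> Pow E. g (x \<in> S) (y \<in> S) (z \<in> S)) S"
      using S gex gey gez dist by (auto simp: wxyz)
  next
    fix S assume S: "S \<subseteq> E"
    then have [simp]: "S - {i} \<subseteq> E" for i by auto
    from att[of "x \<in> S" "y \<in> S" "z \<in> S"]
    show "(\<lambda>S \<in> Pow E. g (x \<in> S) (y \<in> S) (z \<in> S)) S = (\<lambda>S \<in> Pow E. f (x \<in> S) (y \<in> S) (z \<in> S)) S \<or>
      (\<exists>i \<in> S. (\<lambda>S \<in> Pow E. g (x \<in> S) (y \<in> S) (z \<in> S)) S
        = (\<lambda>S \<in> Pow E. f (x \<in> S) (y \<in> S) (z \<in> S)) (S - {i}) + w i)"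
    proof (elim disjE conjE)
      assume "x \<in> S" "g (x \<in> S) (y \<in> S) (z \<in> S) = f False (y \<in> S) (z \<in> S) + wx"
      then show ?thesis using S dist by (intro disjI2 bexI[of _ x]) (auto simp: wxyz)
    next
      assume "y \<in> S" "g (x \<in> S) (y \<in> S) (z \<in> S) = f (x \<in> S) False (z \<in> S) + wy"
      then show ?thesis using S dist by (intro disjI2 bexI[of _ y]) (auto simp: wxyz)
    next
      assume "z \<in> S" "g (x \<in> S) (y \<in> S) (z \<in> S) = f (x \<in> S) (y \<in> S) False + wz"
      then show ?thesis using S dist by (intro disjI2 bexI[of _ z]) (auto simp: wxyz)
    qed (use S in simp)
  qed (use ge in auto)
  ultimately show ?thesis by simp
qed

definition triple_fun :: "real \<Rightarrow> real \<Rightarrow> real \<Rightarrow> real \<Rightarrow> real \<Rightarrow> real \<Rightarrow> real \<Rightarrow> bool \<Rightarrow> bool \<Rightarrow> bool \<Rightarrow> real" where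
  "triple_fun ux uy uz uxy uxz uyz uxyz a b c =
     (if a then if b then if c then uxyz else uxy else if c then uxz else ux
      else if b then if c then uyz else uy else if c then uz else 0)"

text \<open>
  The valuation is the merge of three weighted ranks of rank one. Their weights of \<open>x\<close>, \<open>y\<close>, \<open>z\<close>
  are \<open>a, b, c\<close>, then \<open>e - b, e - a, m\<close>, then \<open>d - b - m, d - a - m, d - e\<close>: the last two lists
  are the marginal values of an item given one or two other items.
\<close>

lemma triple_fun_in_closure:
  assumes dist: "x \<noteq> y" "x \<noteq> z" "y \<noteq> z" and E: "E \<subseteq> {x, y, z}" "E \<subseteq> {1..n}"
    and A: "A \<subseteq> GSV n" "weighted_ranks n \<subseteq> A" "merge_closed A"
    and nonneg: "0 \<le> a" "0 \<le> b" "0 \<le> c" "0 \<le> m"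
    and mono: "a \<le> e" "b \<le> e" "c \<le> a + m" "c \<le> b + m" "e \<le> d" "a + m \<le> d" "b + m \<le> d"
    and submod: "m \<le> c" "e \<le> a + b" "d \<le> e + m" "d + c \<le> a + b + 2 * m"
    and triple: "e + c \<le> a + b + m"
  shows "fun3 x y z E (triple_fun a b c e (a + m) (b + m) d) \<in> A"
proof -
  note step = fun3_merge_rank_one[OF dist E A]
  have "rank_one E (\<lambda>_. 0) \<in> A"
    using A(2) rank_one_in_weighted_ranks[OF E(2), of "\<lambda>_. 0"] by auto
  then have 0: "fun3 x y z E (\<lambda>_ _ _. 0) \<in> A"
    by (simp add: fun3_def rank_one_zero)
  have 1: "fun3 x y z E (triple_fun a b c (max a b) (max a c) (max b c) (max a (max b c))) \<in> A"
    by (rule step[OF 0, of a b c]) (use nonneg in \<open>auto simp: triple_fun_def max_def\<close>)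
  \<comment> \<open>Singletons and pairs have their final values after this merge; only the value of
    the full triple is still too small or already right.\<close>
  have 2: "fun3 x y z E (triple_fun a b c e (a + m) (b + m) (max e (max (a + m) (b + m)))) \<in> A"
    by (rule step[OF 1, of "e - b" "e - a" m])
      (use nonneg mono submod triple in \<open>auto simp: triple_fun_def max_def\<close>)
  show ?thesis
    by (rule step[OF 2, of "d - b - m" "d - a - m" "d - e"])
      (use nonneg mono submod triple in \<open>auto simp: triple_fun_def max_def\<close>)
qed

text \<open>The equation says that \<open>z\<close> has the same marginal value \<open>m\<close>
  given \<open>x\<close> as given \<open>y\<close>, which is the shape required by
  \<open>triple_fun_in_closure\<close>.\<close>

lemma restriction_in_closure:
  assumes dist: "x \<noteq> y" "x \<noteq> z" "y \<noteq> z" and E: "E \<subseteq> {x, y, z}" "E \<subseteq> {1..n}"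
    and A: "A \<subseteq> GSV n" "weighted_ranks n \<subseteq> A" "merge_closed A"
    and val: "valuation ({x, y, z}, u)" and gs: "gross_substitutes ({x, y, z}, u)"
    and eq: "u {x, z} + u {y} = u {y, z} + u {x}" and le: "u {x, y} + u {z} \<le> u {y, z} + u {x}"
  shows "(E, restrict u (Pow E)) \<in> A"
proof -
  let ?E = "{x, y, z}"
  define m where "m = u {x, z} - u {x}"
  have submod: "u (B \<union> C) + u (B \<inter> C) \<le> u B + u C" if "B \<subseteq> ?E" "C \<subseteq> ?E" for B C
    using that by (intro gross_substitutes_submodular[OF _ val gs]) auto
  have mono: "u B \<le> u C" if "B \<subseteq> C" "C \<subseteq> ?E" for B C using valuation_mono[OF val that] .
  have zero: "u {} = 0" using val by (rule valuation_empty)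
  have sets: "{x, y} \<union> {x, z} = ?E" "{x, y} \<inter> {x, z} = {x}" "{x, z} \<union> {y, z} = ?E" "{x, z} \<inter> {y, z} = {z}"
    "{x} \<union> {y} = {x, y}" "{x} \<inter> {y} = {}" "{x} \<union> {z} = {x, z}" "{x} \<inter> {z} = {}"
    using dist by auto
  have sub: "u ?E + u {x} \<le> u {x, y} + u {x, z}" "u ?E + u {z} \<le> u {x, z} + u {y, z}"
    "u {x, y} \<le> u {x} + u {y}" "u {x, z} \<le> u {x} + u {z}"
    using submod[of "{x, y}" "{x, z}"] submod[of "{x, z}" "{y, z}"] submod[of "{x}" "{y}"]
      submod[of "{x}" "{z}"] zero
    unfolding sets by auto
  have m: "u {x} + m = u {x, z}" "u {y} + m = u {y, z}" using eq by (auto simp: m_def)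
  have "fun3 x y z E (triple_fun (u {x}) (u {y}) (u {z}) (u {x, y}) (u {x} + m) (u {y} + m) (u ?E)) \<in> A"
  proof (rule triple_fun_in_closure[OF dist E A])
    show "0 \<le> u {x}" "0 \<le> u {y}" "0 \<le> u {z}"
      using valuation_nonneg[OF val] by auto
    show "0 \<le> m" using mono[of "{x}" "{x, z}"] by (simp add: m_def)
    show "u {x} \<le> u {x, y}" "u {y} \<le> u {x, y}" "u {z} \<le> u {x} + m" "u {z} \<le> u {y} + m"
      "u {x, y} \<le> u ?E" "u {x} + m \<le> u ?E" "u {y} + m \<le> u ?E"
      unfolding m by (auto intro!: mono)
  qed (use sub eq le m in linarith)+
  moreover have "fun3 x y z E (triple_fun (u {x}) (u {y}) (u {z}) (u {x, y}) (u {x, z}) (u {y, z}) (u ?E))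
      = (E, restrict u (Pow E))"
  proof -
    have "triple_fun (u {x}) (u {y}) (u {z}) (u {x, y}) (u {x, z}) (u {y, z}) (u ?E)
        (x \<in> S) (y \<in> S) (z \<in> S) = u S" if "S \<subseteq> E" for S
    proof -
      have "S = (if x \<in> S then {x} else {}) \<union> (if y \<in> S then {y} else {}) \<union> (if z \<in> S then {z} else {})"
        using that E by auto
      also have "u \<dots> = triple_fun (u {x}) (u {y}) (u {z}) (u {x, y}) (u {x, z}) (u {y, z}) (u ?E)
          (x \<in> S) (y \<in> S) (z \<in> S)"
        using zero by (simp add: triple_fun_def insert_commute)
      finally show ?thesis by simp
    qed
    then show ?thesis by (auto simp: fun3_def)
  qed
  ultimately show ?thesis using m by simp
qed

text \<open>By \<open>triple_exchange\<close> the largest of the three sums of a pair and the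
  remaining singleton is attained twice. Renaming the items brings the tie into the position assumed
  in \<open>restriction_in_closure\<close>.\<close>

lemma GSV_subset_MBV:
  assumes n: "n \<le> 3"
  shows "GSV n \<subseteq> MBV n"
proof
  fix U assume U: "U \<in> GSV n"
  obtain E u where Eu: "U = (E, u)" by (cases U)
  have E: "E \<subseteq> {1..n}" and val: "valuation (E, u)" and gs: "gross_substitutes (E, u)"
    using U by (auto simp: Eu GSV_def)
  have fin: "finite E" using E finite_subset by blast
  have U3: "U \<in> GSV 3" using U n by (auto simp: GSV_def)
  \<comment> \<open>extend \<open>u\<close> to the ground set \<open>{1, 2, 3}\<close> by merging it with the zero valuation\<close>
  define Z where "Z = rank_one {1, 2, 3} (\<lambda>_. 0)"
  have Z: "Z = ({1, 2, 3}, \<lambda>S \<in> Pow {1, 2, 3}. 0)"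
    unfolding Z_def by (rule rank_one_zero)
  have "Z \<in> weighted_ranks 3"
    unfolding Z_def by (intro rank_one_in_weighted_ranks) auto
  then have "Z \<in> GSV 3" using weighted_ranks_subset_GSV by blast
  with U3 have merge: "merge U Z \<in> GSV 3" by (rule merge_in_GSV)
  define v where "v = snd (merge U Z)"
  have E3: "E \<subseteq> {1, 2, 3}" using E n by force
  have M: "merge U Z = ({1, 2, 3}, v)"
    using E3 by (intro prod_eqI) (auto simp: v_def Eu Z)
  have vu: "v S = u S" if S: "S \<subseteq> E" for S
  proof (rule antisym)
    have SE: "S \<subseteq> E \<union> {1, 2, 3}" using S by blast
    obtain T R where TR: "T \<subseteq> E" "R \<subseteq> {1, 2, 3}" "T \<union> R = S"
      "snd (merge (E, u) ({1, 2, 3}, \<lambda>S \<in> Pow {1, 2, 3}. 0)) S = u T + (\<lambda>S \<in> Pow {1, 2, 3}. 0) R"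
      by (rule merge_attained[OF fin _ SE, of u "\<lambda>S \<in> Pow {1, 2, 3}. 0"]) auto
    moreover have "u T \<le> u S" using TR S by (intro valuation_mono[OF val]) auto
    ultimately show "v S \<le> u S" by (simp add: v_def Eu Z)
    show "u S \<le> v S"
      using merge_ge[OF fin _ S, of "{1, 2, 3}" "{}" u "\<lambda>S \<in> Pow {1, 2, 3}. 0"] by (simp add: v_def Eu Z)
  qed
  have val3: "valuation ({1, 2, 3}, v)" and gs3: "gross_substitutes ({1, 2, 3}, v)"
    using merge by (simp_all add: M GSV_def)
  \<comment> \<open>The extension \<open>v\<close> belongs to \<open>GSV 3\<close> but perhaps not
    to \<open>A\<close>, so only its restriction \<open>u\<close> is constructed inside
    \<open>A\<close>.\<close>
  have "U \<in> A" if A: "A \<subseteq> GSV n" "weighted_ranks n \<subseteq> A" "merge_closed A" for A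
  proof -
    have res: "restrict v (Pow E) = u"
      using vu val by (intro extensionalityI[of _ "Pow E"]) (auto simp: valuation_def)
    have closure: "U \<in> A" if "{x, y, z} = {1, 2, 3 :: nat}" "x \<noteq> y" "x \<noteq> z" "y \<noteq> z"
      "v {x, z} + v {y} = v {y, z} + v {x}" "v {x, y} + v {z} \<le> v {y, z} + v {x}" for x y z
      using restriction_in_closure[OF that(2,3,4) _ E A _ _ that(5,6)] that(1) E3 val3 gs3
      unfolding res Eu by simp
    have exchange: "v {x, y} + v {z} \<le> max (v {x, z} + v {y}) (v {y, z} + v {x})"
      if "{x, y, z} = {1, 2, 3 :: nat}" "x \<noteq> y" "x \<noteq> z" "y \<noteq> z" for x y z
      using triple_exchange[OF that(2,3,4), of v] val3 gs3 that(1) by simp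
    have perm: "{1, 3, 2} = {1, 2, 3 :: nat}" "{2, 3, 1} = {1, 2, 3 :: nat}" by auto
    define s1 s2 s3 where "s1 = v {2, 3} + v {1}" and "s2 = v {1, 3} + v {2}" and "s3 = v {1, 2} + v {3}"
    have "s3 \<le> max s2 s1" "s2 \<le> max s3 s1" "s1 \<le> max s3 s2"
      using exchange[of 1 2 3] exchange[OF perm(1)] exchange[OF perm(2)]
      by (simp_all add: s1_def s2_def s3_def insert_commute)
    then consider "s2 = s1" "s3 \<le> s1" | "s3 = s1" "s2 \<le> s1" | "s3 = s2" "s1 \<le> s2"
      by (auto simp: max_def split: if_splits)
    then show ?thesis
    proof cases
      case 1
      then show ?thesis
        by (intro closure[of 1 2 3]) (simp_all add: s1_def s2_def s3_def insert_commute)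
    next
      case 2
      then show ?thesis
        by (intro closure[OF perm(1)]) (simp_all add: s1_def s2_def s3_def insert_commute)
    next
      case 3
      then show ?thesis
        by (intro closure[OF perm(2)]) (simp_all add: s1_def s2_def s3_def insert_commute)
    qed
  qed
  then show "U \<in> MBV n" unfolding MBV_def by blast
qed

theorem theorem1p2:
  shows "(\<forall>n::nat. 1 \<le> n \<and> n \<le> 3 \<longrightarrow> MBV n = GSV n) \<and>
         (\<forall>n::nat. 4 \<le> n \<longrightarrow> MBV n \<subset> GSV n)"
  by (intro conjI allI impI antisym MBV_subset_GSV GSV_subset_MBV MBV_psubset_GSV) auto

end
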